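(* Let $D=\{(p,q)\in\mathbb{R}^2: p<q\}$. The function $\Theta$ is continuous on $D\times(1,\infty)$ and satisfies, for $r>1$: $\lim_{p\to-\infty}\Theta(p,q,r)=\arccos\frac1r$ (for fixed $q,r$); $\lim_{q\to+\infty}\Theta(p,q,r)=\arccos\frac1r$ (for fixed $p,r$); $\lim_{r\to1}\Theta(p,q,r)=\frac{\pi}{\sqrt{q-p}}$ for $(p,q)\in D$; $\lim_{r\to\infty}\Theta(p,q,r)=\frac{\pi}{2}$ if $p<0<q$; $\lim_{r\to\infty}\Theta(p,q,r)=\frac{q}{q-p}\cdot\frac{\pi}{2}$ if $0\le p<q$. Moreover, for all $r>1$, $\Theta(1,2,r)=\pi$, $\Theta(-2,-1,r)=\pi$, and $\Theta(-2,2,r)=\frac{\pi}{2}$.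
   Context: For $p<q$ and $r>1$ define the period function $$\Theta(p,q,r)=\int_1^r\frac{dx}{\sqrt{\left(\frac{r^p-r^q}{r^p-1}+\frac{r^q-1}{r^p-1}x^p\right)^{2/q}-x^2}}\quad (p\ne0,\ q\ne0),$$ $$\Theta(0,q,r)=\int_1^r\frac{dx}{\sqrt{\left(1+\frac{r^q-1}{\log r}\log x\right)^{2/q}-x^2}},\qquad \Theta(p,0,r)=\int_1^r\frac{dx}{\sqrt{r^{\frac{2(x^p-1)}{r^p-1}}-x^2}}.$$ It is the total curvature of the strictly locally convex curve arc between consecutive minimum and maximum of a solution $u$ of $u^{1-p}(u_\theta^2+u^2)^{(q-2)/2}(u_{\theta\theta}+u)=1$ with $\max u/\min u=r$. *)

theory Defs
  imports "HOL-Analysis.Analysis"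
begin

text \<open>The integrand of the period function, in its three cases
  (p = 0, q = 0, and p, q both nonzero).  Note p < q excludes p = q = 0.\<close>

definition Theta_integrand :: "real \<Rightarrow> real \<Rightarrow> real \<Rightarrow> real \<Rightarrow> real" where
  "Theta_integrand p q r x =
     (if p = 0 then
        1 / sqrt ((1 + (r powr q - 1) / ln r * ln x) powr (2 / q) - x\<^sup>2)
      else if q = 0 then
        1 / sqrt (r powr (2 * (x powr p - 1) / (r powr p - 1)) - x\<^sup>2)
      else
        1 / sqrt (((r powr p - r powr q) / (r powr p - 1)
                   + (r powr q - 1) / (r powr p - 1) * x powr p) powr (2 / q) - x\<^sup>2))"

text \<open>The (improper, but absolutely convergent) integral over [1, r],
  taken as a Henstock--Kurzweil integral.\<close>

definition Theta :: "real \<Rightarrow> real \<Rightarrow> real \<Rightarrow> real" where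
  "Theta p q r = integral {1..r} (Theta_integrand p q r)"

end

theory Submission
  imports Defs "HOL-Real_Asymp.Real_Asymp"
begin

text \<open>
  Put \<open>x = exp v\<close> and \<open>r = exp L\<close>. Then the integral becomes that of \<open>1 / sqrt (exp (2 * D v) - 1)\<close>
  over \<open>0 < v < L\<close>, with \<open>D v = S v - v\<close>, where \<open>S\<close> is the increasing self-map of \<open>[0, L]\<close> that makes
  \<open>exp (q * S v)\<close> an affine function of \<open>exp (p * v)\<close>. All cases, \<open>p = 0\<close> and \<open>q = 0\<close> included, are
  covered by \<open>S' = (K + p * y) / (1 + q * y)\<close> with \<open>y\<close> increasing in \<open>v\<close>. This derivative is decreasing
  because \<open>p \<le> q * K\<close>, so \<open>D\<close> is concave and vanishes at both ends; hence
  \<open>D v \<ge> 2 / L * min v (L - v) * D (L / 2)\<close>, and \<open>D (L / 2)\<close> is explicit.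

  As long as \<open>L\<^sup>2 / D (L / 2)\<close> stays bounded, this dominates the integrand, rescaled to \<open>(0, 1)\<close>, by
  a multiple of \<open>1 / sqrt (t * (1 - t))\<close>; dominated convergence then gives the continuity and the limits
  \<open>p \<rightarrow> - \<infinity>\<close>, \<open>q \<rightarrow> \<infinity>\<close> and \<open>r \<rightarrow> 1\<close>. For \<open>r \<rightarrow> \<infinity>\<close> the interval is cut at \<open>L / 2\<close> and each half is
  parametrised by the distance to its end of \<open>[0, L]\<close>. There \<open>D\<close> is bounded below by a fixed linear
  function of that distance; the left half tends to \<open>0\<close>, the right half to the integral of
  \<open>1 / sqrt (exp (2 * c * w) - 1)\<close> over \<open>w > 0\<close> with \<open>c = 1 - max 0 p / q\<close>, that is \<open>pi / (2 * c)\<close>.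
\<close>

section \<open>Removable singularities of \<open>(exp z - 1) / z\<close> and \<open>ln (1 + z) / z\<close>\<close>

text \<open>The value filled in at 0 is the limit there, so that formulas in \<open>p\<close> and
  \<open>q\<close> stay valid and continuous across \<open>p = 0\<close> and
  \<open>q = 0\<close>.\<close>

definition expm1_quot :: "real \<Rightarrow> real" where
  "expm1_quot z = (if z = 0 then 1 else (exp z - 1) / z)"

definition ln1p_quot :: "real \<Rightarrow> real" where
  "ln1p_quot z = (if z = 0 then 1 else ln (1 + z) / z)"

lemma expm1_quot_pos: "expm1_quot z > 0"
proof (cases z "0::real" rule: linorder_cases)
  case less
  then show ?thesis by (simp add: expm1_quot_def zero_less_divide_iff)
qed (simp_all add: expm1_quot_def)

lemma mult_expm1_quot: "z * expm1_quot z = exp z - 1"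
  by (simp add: expm1_quot_def)

lemma mult_ln1p_quot: "z * ln1p_quot z = ln (1 + z)"
  by (simp add: ln1p_quot_def)

lemma expm1_quot_0 [simp]: "expm1_quot 0 = 1"
  and ln1p_quot_0 [simp]: "ln1p_quot 0 = 1"
  by (simp_all add: expm1_quot_def ln1p_quot_def)

text \<open>The value is the second Taylor coefficient of \<open>exp\<close> at 0. It yields
  continuity at 0 and, later, the expansion of \<open>gap\<close> for small
  \<open>L\<close>.\<close>

lemma has_real_derivative_expm1_quot_0: "(expm1_quot has_real_derivative 1 / 2) (at 0)"
proof -
  have "((\<lambda>h::real. ((exp h - 1) / h - 1) / h) \<longlongrightarrow> 1 / 2) (at 0)"
    by real_asymp
  moreover have "\<forall>\<^sub>F h::real in at 0. ((exp h - 1) / h - 1) / h = (expm1_quot (0 + h) - expm1_quot 0) / h"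
    by (auto simp: eventually_at_filter expm1_quot_def)
  ultimately show ?thesis
    unfolding DERIV_def by (rule Lim_transform_eventually)
qed

lemma has_real_derivative_ln1p_quot_0: "(ln1p_quot has_real_derivative - (1 / 2)) (at 0)"
proof -
  have "((\<lambda>h::real. (ln (1 + h) / h - 1) / h) \<longlongrightarrow> - (1 / 2)) (at 0)"
    by real_asymp
  moreover have "\<forall>\<^sub>F h::real in at 0. (ln (1 + h) / h - 1) / h = (ln1p_quot (0 + h) - ln1p_quot 0) / h"
    by (auto simp: eventually_at_filter ln1p_quot_def)
  ultimately show ?thesis
    unfolding DERIV_def by (rule Lim_transform_eventually)
qed

lemma isCont_expm1_quot: "isCont expm1_quot z"
proof (cases "z = 0")
  case True
  then show ?thesis using has_real_derivative_expm1_quot_0 DERIV_isCont by blast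
next
  case False
  have "isCont (\<lambda>z::real. (exp z - 1) / z) z"
    using False by (intro continuous_intros) auto
  moreover have "\<forall>\<^sub>F w in nhds z. expm1_quot w = (exp w - 1) / w"
    using t1_space_nhds[OF False] by eventually_elim (simp add: expm1_quot_def)
  ultimately show ?thesis
    using isCont_cong by force
qed

lemma isCont_ln1p_quot:
  assumes "z > -1"
  shows "isCont ln1p_quot z"
proof (cases "z = 0")
  case True
  then show ?thesis using has_real_derivative_ln1p_quot_0 DERIV_isCont by blast
next
  case False
  have "isCont (\<lambda>z::real. ln (1 + z) / z) z"
    using False assms by (intro continuous_intros) auto
  moreover have "\<forall>\<^sub>F w in nhds z. ln1p_quot w = ln (1 + w) / w"
    using t1_space_nhds[OF False] by eventually_elim (simp add: ln1p_quot_def)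
  ultimately show ?thesis
    using isCont_cong by force
qed

lemmas tendsto_expm1_quot [tendsto_intros] = isCont_tendsto_compose[OF isCont_expm1_quot]
lemmas tendsto_ln1p_quot = isCont_tendsto_compose[OF isCont_ln1p_quot]

section \<open>Logarithmic coordinates\<close>

text \<open>\<open>pint p v\<close> is the integral of \<open>exp (p * u)\<close> over \<open>[0, v]\<close>,
  and \<open>pinv q\<close> is the inverse of \<open>pint q\<close>.\<close>

definition pint :: "real \<Rightarrow> real \<Rightarrow> real" where
  "pint p v = v * expm1_quot (p * v)"

definition pinv :: "real \<Rightarrow> real \<Rightarrow> real" where
  "pinv q y = y * ln1p_quot (q * y)"

section \<open>Calculus of \<open>pint\<close> and its inverse \<open>pinv\<close>\<close>

lemma pint_0 [simp]: "pint p 0 = 0"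
  by (simp add: pint_def)

lemma pinv_0 [simp]: "pinv q 0 = 0"
  by (simp add: pinv_def)

lemma pint_0_left [simp]: "pint 0 v = v"
  by (simp add: pint_def)

lemma pinv_0_left [simp]: "pinv 0 v = v"
  by (simp add: pinv_def)

lemma mult_pint: "p * pint p v = exp (p * v) - 1"
  using mult_expm1_quot[of "p * v"] by (simp add: pint_def mult_ac)

lemma pint_eq: "p \<noteq> 0 \<Longrightarrow> pint p v = (exp (p * v) - 1) / p"
  using mult_pint[of p v] by (simp add: field_simps)

lemma mult_pinv: "q * pinv q y = ln (1 + q * y)"
  using mult_ln1p_quot[of "q * y"] by (simp add: pinv_def mult_ac)

lemma pinv_eq: "q \<noteq> 0 \<Longrightarrow> pinv q y = ln (1 + q * y) / q"
  using mult_pinv[of q y] by (simp add: field_simps)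

lemma pint_pos: "v > 0 \<Longrightarrow> pint p v > 0"
  by (simp add: pint_def expm1_quot_pos)

lemma pinv_pint [simp]: "pinv q (pint q v) = v"
  by (cases "q = 0") (simp_all add: pinv_eq mult_pint)

lemma has_real_derivative_pint: "(pint p has_real_derivative exp (p * v)) (at v)"
proof (cases "p = 0")
  case True
  then have "pint p = (\<lambda>v. v)" by auto
  then show ?thesis using True by simp
next
  case False
  then have "pint p = (\<lambda>v. (exp (p * v) - 1) / p)" by (auto simp: pint_eq)
  moreover have "((\<lambda>v. (exp (p * v) - 1) / p) has_real_derivative exp (p * v)) (at v)"
    using False by (auto intro!: derivative_eq_intros)
  ultimately show ?thesis by simp
qed

lemma pint_strict_mono: "u < v \<Longrightarrow> pint p u < pint p v"
  by (rule DERIV_pos_imp_increasing) (auto intro: has_real_derivative_pint)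

lemma pint_mono: "u \<le> v \<Longrightarrow> pint p u \<le> pint p v"
  using pint_strict_mono[of u v p] by (cases "u = v") auto

lemma has_real_derivative_pinv:
  assumes "1 + q * y > 0"
  shows "(pinv q has_real_derivative 1 / (1 + q * y)) (at y)"
proof (cases "q = 0")
  case True
  then have "pinv q = (\<lambda>v. v)" by auto
  then show ?thesis using True by simp
next
  case False
  then have "pinv q = (\<lambda>y. ln (1 + q * y) / q)" by (auto simp: pinv_eq)
  moreover have "((\<lambda>y. ln (1 + q * y) / q) has_real_derivative 1 / (1 + q * y)) (at y)"
    using False assms by (auto intro!: derivative_eq_intros)
  ultimately show ?thesis by simp
qed

lemma pinv_strict_mono:
  assumes "y < z" "1 + q * y > 0" "1 + q * z > 0"
  shows "pinv q y < pinv q z"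
proof (rule DERIV_pos_imp_increasing[OF assms(1)])
  fix x assume "y \<le> x" "x \<le> z"
  \<comment> \<open>An affine function of \<open>x\<close> is at least the smaller of its end
    values, whatever the sign of \<open>q\<close>.\<close>
  then have "q * y \<le> q * x \<or> q * z \<le> q * x"
    by (cases "q \<ge> 0") (auto intro: mult_left_mono mult_left_mono_neg)
  then have "1 + q * x > 0" using assms by linarith
  then show "\<exists>d. (pinv q has_real_derivative d) (at x) \<and> 0 < d"
    using has_real_derivative_pinv by fastforce
qed

lemma tendsto_pint [tendsto_intros]:
  assumes "(f \<longlongrightarrow> p) F" "(g \<longlongrightarrow> v) F"
  shows "((\<lambda>x. pint (f x) (g x)) \<longlongrightarrow> pint p v) F"
  unfolding pint_def by (intro tendsto_intros assms)

lemma tendsto_pinv: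
  assumes "(f \<longlongrightarrow> q) F" "(g \<longlongrightarrow> y) F" "1 + q * y > 0"
  shows "((\<lambda>x. pinv (f x) (g x)) \<longlongrightarrow> pinv q y) F"
  unfolding pinv_def by (intro tendsto_intros tendsto_ln1p_quot assms) (use assms in simp)

text \<open>In logarithmic coordinates \<open>x = exp v\<close>, \<open>r = exp L\<close>, the term under the square root
  is \<open>exp (2 * interp p q L v) - exp (2 * v)\<close>.\<close>

definition interp :: "real \<Rightarrow> real \<Rightarrow> real \<Rightarrow> real \<Rightarrow> real" where
  "interp p q L v = pinv q (pint q L / pint p L * pint p v)"

text \<open>In the notation of the introduction, \<open>interp p q L\<close> is \<open>S\<close> and
  \<open>gap p q L\<close> is \<open>D\<close>.\<close>

definition gap :: "real \<Rightarrow> real \<Rightarrow> real \<Rightarrow> real \<Rightarrow> real" where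
  "gap p q L v = interp p q L v - v"

text \<open>The factor \<open>exp v\<close> extracted from the root cancels against the Jacobian of
  \<open>x = exp v\<close>, so this is the whole integrand in \<open>v\<close>.\<close>

definition Jint :: "real \<Rightarrow> real \<Rightarrow> real \<Rightarrow> real \<Rightarrow> real" where
  "Jint p q L v = 1 / sqrt (exp (2 * gap p q L v) - 1)"

text \<open>The expression is a convex combination of \<open>1\<close> and
  \<open>exp (q * L)\<close> with weight \<open>R = pint p v / pint p L\<close> in
  \<open>[0, 1]\<close>.\<close>

lemma interp_arg_pos:
  assumes "L > 0" "0 \<le> v" "v \<le> L"
  shows "1 + q * (pint q L / pint p L * pint p v) > 0"
proof -
  define R where "R = pint p v / pint p L"
  have R: "0 \<le> R" "R \<le> 1"
    using assms pint_mono[of 0 v p] pint_mono[of v L p] pint_pos[of L p]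
    by (auto simp: R_def)
  have "1 + q * (pint q L / pint p L * pint p v) = (1 - R) + R * exp (q * L)"
  proof -
    have "q * (pint q L / pint p L * pint p v) = R * (q * pint q L)" by (simp add: R_def)
    then show ?thesis by (simp add: mult_pint algebra_simps)
  qed
  also have "\<dots> > 0"
  proof (cases "R = 1")
    case False
    with R show ?thesis by (intro add_pos_nonneg) auto
  qed simp
  finally show ?thesis .
qed

section \<open>Concavity of the gap and its lower bound\<close>

lemma gap_0 [simp]: "gap p q L 0 = 0"
  by (simp add: gap_def interp_def)

lemma gap_end: "L > 0 \<Longrightarrow> gap p q L L = 0"
  using pint_pos[of L p] by (simp add: gap_def interp_def)

lemma has_real_derivative_gap:
  fixes p q L
  defines "K \<equiv> pint q L / pint p L"
  assumes "L > 0" "0 \<le> v" "v \<le> L"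
  shows "(gap p q L has_real_derivative K * exp (p * v) / (1 + q * (K * pint p v)) - 1) (at v)"
proof -
  have "((\<lambda>v. pinv q (K * pint p v)) has_real_derivative
      1 / (1 + q * (K * pint p v)) * (K * exp (p * v))) (at v)"
    by (rule DERIV_chain2[OF has_real_derivative_pinv])
      (use interp_arg_pos[OF assms(2-4)] in
        \<open>auto simp: K_def simp del: times_divide_eq_left intro!: DERIV_cmult has_real_derivative_pint\<close>)
  then show ?thesis
    unfolding gap_def[abs_def] interp_def K_def[symmetric]
    by (intro DERIV_diff) auto
qed

lemma concave_gap:
  assumes "L > 0" "p \<le> q"
  shows "concave_on {0..L} (gap p q L)"
proof -
  define K where "K = pint q L / pint p L"
  define f' where "f' v = - (K * exp (p * v) / (1 + q * (K * pint p v)) - 1)" for v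
  have K: "K > 0" using assms pint_pos by (simp add: K_def)
  \<comment> \<open>The two sides are \<open>exp (p * L) - 1\<close> and
    \<open>exp (q * L) - 1\<close>; division by \<open>pint p L\<close> gives the sign condition
    \<open>p \<le> q * K\<close>.\<close>
  have "p * pint p L \<le> q * pint q L"
    using assms by (simp add: mult_pint)
  then have pqK: "p \<le> q * K"
    using pint_pos[of L p] assms by (simp add: K_def field_simps)
  have "convex_on {0..L} (\<lambda>v. - gap p q L v)"
  proof (rule convex_on_realI[where f' = f'])
    fix u v assume uv: "u \<in> {0..L}" "v \<in> {0..L}" "u \<le> v"
    define yu yv where "yu = K * pint p u" and "yv = K * pint p v"
    have y: "yu \<le> yv" using K pint_mono[OF uv(3)] by (simp add: yu_def yv_def)
    have pos: "1 + q * yu > 0" "1 + q * yv > 0"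
      using interp_arg_pos[of L u q p] interp_arg_pos[of L v q p] uv assms
      by (auto simp: yu_def yv_def K_def)
    \<comment> \<open>In the variable \<open>y = K * pint p v\<close> the derivative of
      \<open>interp\<close> is the fractional linear function
      \<open>(K + p * y) / (1 + q * y)\<close>.\<close>
    have e: "K * exp (p * u) = K + p * yu" "K * exp (p * v) = K + p * yv"
      by (simp_all add: yu_def yv_def mult.left_commute[of p K] mult_pint algebra_simps)
    \<comment> \<open>Cross-multiplying the two fractions below leaves exactly this product.\<close>
    have "(q * K - p) * (yv - yu) \<ge> 0" using y pqK by simp
    then have "(K + p * yv) / (1 + q * yv) \<le> (K + p * yu) / (1 + q * yu)"
      using pos by (simp add: divide_simps) (simp add: algebra_simps)
    then show "f' u \<le> f' v" by (simp add: f'_def e flip: yu_def yv_def)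
  qed (use has_real_derivative_gap[OF assms(1)] in
        \<open>auto simp: K_def f'_def intro!: DERIV_minus simp del: minus_diff_eq\<close>)
  then show ?thesis by (simp add: concave_on_def)
qed

text \<open>For \<open>p \<noteq> 0\<close>, \<open>exp (p * L) - 1\<close> is a difference of
  squares with the factors \<open>exp (p * L / 2) - 1\<close> and
  \<open>exp (p * L / 2) + 1\<close>.\<close>

lemma pint_half: "L > 0 \<Longrightarrow> pint p (L / 2) / pint p L = 1 / (exp (p * L / 2) + 1)"
proof -
  assume "L > 0"
  have "pint p L = pint p (L / 2) * (exp (p * L / 2) + 1)"
  proof (cases "p = 0")
    case False
    have "exp (p * L) = exp (p * L / 2) * exp (p * L / 2)"
      by (simp flip: exp_add)
    then show ?thesis using False by (simp add: pint_eq field_simps)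
  qed simp
  then show ?thesis using pint_pos[of "L/2" p] \<open>L > 0\<close> by simp
qed

text \<open>By \<open>pint_half\<close> the share of \<open>pint p L\<close> reached at the midpoint
  decreases strictly in \<open>p\<close>. Hence the argument of \<open>pinv q\<close> exceeds
  \<open>pint q (L / 2)\<close>, whose image is \<open>L / 2\<close>.\<close>

lemma gap_half_pos:
  assumes "L > 0" "p < q"
  shows "gap p q L (L / 2) > 0"
proof -
  have "exp (p * L / 2) < exp (q * L / 2)" using assms by simp
  then have "1 / (exp (q * L / 2) + 1) < 1 / (exp (p * L / 2) + 1)"
    by (intro divide_strict_left_mono) (auto intro!: mult_pos_pos add_pos_pos)
  then have "pint q (L / 2) / pint q L < pint p (L / 2) / pint p L"
    using assms by (simp add: pint_half)
  then have *: "pint q (L / 2) < pint q L / pint p L * pint p (L / 2)"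
    using pint_pos[of L q] assms by (simp add: field_simps)
  have "pinv q (pint q (L / 2)) < pinv q (pint q L / pint p L * pint p (L / 2))"
    by (rule pinv_strict_mono[OF *]) (use assms interp_arg_pos[of L "L/2" q p] in \<open>auto simp: mult_pint\<close>)
  then show ?thesis by (simp add: gap_def interp_def)
qed

text \<open>The chords from the midpoint to the two ends, where \<open>gap\<close> vanishes, lie
  below the graph of a concave function.\<close>

lemma gap_ge:
  assumes "L > 0" "p < q" "0 \<le> v" "v \<le> L"
  shows "gap p q L v \<ge> 2 / L * min v (L - v) * gap p q L (L / 2)"
proof (cases "v \<le> L / 2")
  case True
  define t where "t = 2 * v / L"
  have t: "0 \<le> t" "t \<le> 1" "(1 - t) * 0 + t * (L / 2) = v"
    using assms True by (auto simp: t_def field_simps)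
  have "gap p q L ((1 - t) *\<^sub>R 0 + t *\<^sub>R (L / 2)) \<ge> (1 - t) * gap p q L 0 + t * gap p q L (L / 2)"
    using concave_gap[of L p q] assms t by (intro concave_onD) auto
  then show ?thesis using t True by (simp add: t_def min_def field_simps)
next
  case False
  define t where "t = 2 * (L - v) / L"
  have t: "0 \<le> t" "t \<le> 1" "(1 - t) * L + t * (L / 2) = v"
    using assms False by (auto simp: t_def field_simps)
  have "gap p q L ((1 - t) *\<^sub>R L + t *\<^sub>R (L / 2)) \<ge> (1 - t) * gap p q L L + t * gap p q L (L / 2)"
    using concave_gap[of L p q] assms t by (intro concave_onD) auto
  then show ?thesis using t False gap_end[of L p q] assms by (simp add: t_def min_def field_simps)
qed

lemma gap_pos:
  assumes "L > 0" "p < q" "0 < v" "v < L"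
  shows "gap p q L v > 0"
proof -
  have "0 < 2 / L * min v (L - v) * gap p q L (L / 2)"
    using assms gap_half_pos by auto
  then show ?thesis using gap_ge[of L p q v] assms by simp
qed

text \<open>The three cases of the integrand merge: for \<open>q \<noteq> 0\<close> the base of the
  power is \<open>1 + q * y\<close>, and for \<open>q = 0\<close> the power of \<open>r\<close> is
  \<open>exp (2 * y)\<close>, where \<open>pinv 0 y = y\<close>.\<close>

lemma Theta_integrand_exp:
  assumes "L > 0" "p < q" "0 \<le> v" "v \<le> L"
  shows "Theta_integrand p q (exp L) (exp v) = exp (- v) * Jint p q L v"
proof -
  define y where "y = pint q L / pint p L * pint p v"
  have pos: "1 + q * y > 0" using interp_arg_pos assms by (simp add: y_def)
  have "Theta_integrand p q (exp L) (exp v) = 1 / sqrt (exp (2 * interp p q L v) - (exp v)\<^sup>2)"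
  proof -
    have nq: "(1 + q * y) powr (2 / q) = exp (2 * interp p q L v)" if "q \<noteq> 0"
    proof -
      have "interp p q L v = pinv q y" by (simp add: interp_def y_def)
      then show ?thesis using that pos by (simp add: powr_def pinv_eq)
    qed
    consider "p = 0" "q \<noteq> 0" | "p \<noteq> 0" "q = 0" | "p \<noteq> 0" "q \<noteq> 0" using assms by force
    then show ?thesis
    proof cases
      case 1
      have "1 + (exp L powr q - 1) / ln (exp L) * ln (exp v) = 1 + q * y"
        using 1 by (simp add: y_def pint_eq powr_def)
      then show ?thesis using 1 nq by (simp add: Theta_integrand_def)
    next
      case 2
      have "exp L powr (2 * (exp v powr p - 1) / (exp L powr p - 1)) = exp (2 * y)"
        using 2 by (simp add: y_def pint_eq powr_def mult_ac)
      then show ?thesis using 2 by (simp add: Theta_integrand_def interp_def y_def)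
    next
      case 3
      have "exp (p * L) - 1 \<noteq> 0" using 3 assms by simp
      then have "(exp L powr p - exp L powr q) / (exp L powr p - 1)
          + (exp L powr q - 1) / (exp L powr p - 1) * exp v powr p = 1 + q * y"
        using 3 by (simp add: y_def pint_eq powr_def divide_simps) (simp add: algebra_simps)
      then show ?thesis using 3 nq by (simp add: Theta_integrand_def)
    qed
  qed
  also have "exp (2 * interp p q L v) - (exp v)\<^sup>2 = (exp v)\<^sup>2 * (exp (2 * gap p q L v) - 1)"
    by (simp add: gap_def right_diff_distrib' exp_diff flip: exp_double)
  finally show ?thesis
    by (simp only: Jint_def real_sqrt_mult) (simp add: exp_minus field_simps)
qed

section \<open>Integral representation and dominated convergence\<close>

text \<open>The antiderivative is \<open>arcsin (h x)\<close>. Differentiability is asked for in the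
  interior only, since \<open>h\<close> may reach 1 or -1 at the ends, where \<open>arcsin\<close>
  has infinite slope. Every explicit integral below is of this type.\<close>

lemma has_integral_arcsin_comp:
  fixes h :: "real \<Rightarrow> real"
  assumes "a \<le> b" "continuous_on {a..b} h" "\<And>x. a \<le> x \<Longrightarrow> x \<le> b \<Longrightarrow> \<bar>h x\<bar> \<le> 1"
    and "\<And>x. a < x \<Longrightarrow> x < b \<Longrightarrow> (h has_real_derivative h' x) (at x)"
    and "\<And>x. a < x \<Longrightarrow> x < b \<Longrightarrow> \<bar>h x\<bar> < 1"
    and f: "\<And>x. a < x \<Longrightarrow> x < b \<Longrightarrow> f x = h' x / sqrt (1 - (h x)\<^sup>2)"
  shows "(f has_integral arcsin (h b) - arcsin (h a)) {a<..<b}"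
proof -
  have "((\<lambda>x. h' x / sqrt (1 - (h x)\<^sup>2)) has_integral arcsin (h b) - arcsin (h a)) {a..b}"
  proof (rule fundamental_theorem_of_calculus_interior[OF assms(1)])
    show "continuous_on {a..b} (\<lambda>x. arcsin (h x))"
      using assms(2,3) by (intro continuous_on_arcsin) (auto simp: abs_le_iff)
    fix x assume x: "x \<in> {a<..<b}"
    have "((\<lambda>x. arcsin (h x)) has_real_derivative inverse (sqrt (1 - (h x)\<^sup>2)) * h' x) (at x)"
      using assms(4,5)[of x] x by (intro DERIV_chain2[OF DERIV_arcsin]) auto
    then show "((\<lambda>x. arcsin (h x)) has_vector_derivative h' x / sqrt (1 - (h x)\<^sup>2)) (at x)"
      by (simp add: has_real_derivative_iff_has_vector_derivative divide_inverse mult.commute)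
  qed
  then have "((\<lambda>x. h' x / sqrt (1 - (h x)\<^sup>2)) has_integral arcsin (h b) - arcsin (h a)) {a<..<b}"
    by (simp add: has_integral_Icc_iff_Ioo)
  then show ?thesis
    by (rule has_integral_eq[rotated]) (use f in simp)
qed

text \<open>This is the dominating function while \<open>L\<close> stays bounded and, up to a
  factor, the limit integrand for \<open>r \<rightarrow> 1\<close>.\<close>

lemma has_integral_inverse_sqrt_parabola:
  "((\<lambda>t. 1 / sqrt (t * (1 - t))) has_integral pi) {0<..<1::real}"
proof -
  have "((\<lambda>t. 1 / sqrt (t * (1 - t))) has_integral arcsin (2 * 1 - 1) - arcsin (2 * 0 - 1)) {0<..<1::real}"
  proof (rule has_integral_arcsin_comp[where h' = "\<lambda>_. 2"])
    fix t :: real assume "0 < t" "t < 1"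
    have "1 - (2 * t - 1)\<^sup>2 = 2\<^sup>2 * (t * (1 - t))" by (simp add: power2_eq_square algebra_simps)
    then show "1 / sqrt (t * (1 - t)) = 2 / sqrt (1 - (2 * t - 1)\<^sup>2)"
      by (simp add: real_sqrt_mult)
  qed (auto intro!: continuous_intros derivative_eq_intros)
  then show ?thesis by simp
qed

text \<open>With \<open>w = - ln y\<close> this is the integral of
  \<open>1 / sqrt (exp (2 * c * w) - 1)\<close> over the half-line, and \<open>1 / y\<close> is the
  Jacobian. After multiplication by \<open>c\<close>, the antiderivative is
  \<open>arcsin (y powr c)\<close>.\<close>

lemma has_integral_inverse_sqrt_powr:
  assumes "c > 0"
  shows "((\<lambda>y. 1 / y / sqrt (exp (2 * (c * - ln y)) - 1)) has_integral pi / (2 * c)) {0<..<1::real}"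
proof -
  have "((\<lambda>y. c * (1 / y / sqrt (exp (2 * (c * - ln y)) - 1))) has_integral
      arcsin (1 powr c) - arcsin (0 powr c)) {0<..<1::real}"
  proof (rule has_integral_arcsin_comp[where h' = "\<lambda>y. c * y powr (c - 1)"])
    show "continuous_on {0..1} (\<lambda>x::real. x powr c)"
      using assms by (intro continuous_on_powr') (auto intro!: continuous_intros)
    fix y :: real assume y: "0 < y" "y < 1"
    then have "y powr c < 1 powr c" using assms by (intro powr_less_mono2) auto
    then show "\<bar>y powr c\<bar> < 1" using y by simp
    have e: "exp (2 * (c * - ln y)) = 1 / (y powr c)\<^sup>2"
      using y by (simp add: powr_def exp_minus power2_eq_square inverse_eq_divide flip: exp_add)
    have "exp (2 * (c * - ln y)) - 1 = (1 - (y powr c)\<^sup>2) / (y powr c)\<^sup>2"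
      using y unfolding e by (simp add: field_simps)
    then have "sqrt (exp (2 * (c * - ln y)) - 1) = sqrt (1 - (y powr c)\<^sup>2) / (y powr c)"
      using y by (simp add: real_sqrt_divide)
    then show "c * (1 / y / sqrt (exp (2 * (c * - ln y)) - 1))
        = c * y powr (c - 1) / sqrt (1 - (y powr c)\<^sup>2)"
      using y by (simp add: powr_diff)
    show "((\<lambda>y. y powr c) has_real_derivative c * y powr (c - 1)) (at y)"
      using y by (auto intro!: derivative_eq_intros)
  qed (use assms in \<open>auto intro!: powr_le1\<close>)
  from has_integral_mult_right[OF this, of "1 / c"] show ?thesis
    using assms by (simp add: field_simps)
qed

section \<open>Domination and convergence on the fixed interval \<open>(0, 1)\<close>\<close>

lemma continuous_on_Jint:
  assumes "L > 0" "p < q"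
  shows "continuous_on {0<..<L} (Jint p q L)"
proof -
  have "continuous_on {0<..<L} (gap p q L)"
    by (intro continuous_at_imp_continuous_on ballI DERIV_isCont[OF has_real_derivative_gap]) (use assms in auto)
  then show ?thesis
    using gap_pos[OF assms] unfolding Jint_def[abs_def]
    by (intro continuous_intros) fastforce+
qed

lemma Jint_nonneg: "Jint p q L v \<ge> 0" if "L > 0" "p < q" "0 < v" "v < L"
  using gap_pos[OF that] by (simp add: Jint_def)

text \<open>This combines \<open>gap_ge\<close> with \<open>exp z - 1 \<ge> z\<close>. The bound
  depends on \<open>p\<close>, \<open>q\<close> and \<open>L\<close> only through \<open>C\<close>,
  so it dominates whole families of integrands.\<close>

lemma Jint_le:
  assumes "L > 0" "p < q" "0 < t" "t < 1" and C: "L\<^sup>2 \<le> C * gap p q L (L / 2)"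
  shows "L * Jint p q L (L * t) \<le> sqrt C / 2 * (1 / sqrt (t * (1 - t)))"
proof -
  define G where "G = gap p q L (L / 2)"
  have G: "G > 0" using gap_half_pos assms by (simp add: G_def)
  then have "C > 0" using C assms by (smt (verit) G_def mult_nonneg_nonpos2 mult.commute zero_less_power)
  have tt: "0 < t * (1 - t)" using assms by simp
  \<comment> \<open>The product replaces the minimum because its inverse square root has an explicit
    integral.\<close>
  have "t * (1 - t) \<le> min t (1 - t)" using assms by (simp add: min_def mult_left_le mult_left_le_one_le)
  then have "2 * (t * (1 - t)) * G \<le> 2 * min t (1 - t) * G"
    using G by (intro mult_right_mono) auto
  also have "\<dots> = 2 / L * min (L * t) (L - L * t) * G"
  proof -
    have "min (L * t) (L - L * t) = L * min t (1 - t)"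
      using assms min_mult_distrib_left[of L t "1 - t"] by (simp add: right_diff_distrib')
    then show ?thesis using assms by simp
  qed
  also have "\<dots> \<le> gap p q L (L * t)"
    unfolding G_def using assms by (intro gap_ge) auto
  also have "\<dots> \<le> (exp (2 * gap p q L (L * t)) - 1) / 2"
    using exp_ge_add_one_self[of "2 * gap p q L (L * t)"] by (simp add: field_simps)
  finally have "4 * (t * (1 - t)) * G \<le> exp (2 * gap p q L (L * t)) - 1" by simp
  moreover have "4 * (t * (1 - t)) * (L\<^sup>2 / C) \<le> 4 * (t * (1 - t)) * G"
    using C \<open>C > 0\<close> tt by (intro mult_left_mono) (auto simp: G_def field_simps)
  ultimately have "sqrt (4 * (t * (1 - t)) * (L\<^sup>2 / C)) \<le> sqrt (exp (2 * gap p q L (L * t)) - 1)"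
    by simp
  also have "sqrt (4 * (t * (1 - t)) * (L\<^sup>2 / C)) = 2 * sqrt (t * (1 - t)) * L / sqrt C"
    using assms by (simp add: real_sqrt_mult real_sqrt_divide)
  finally have "L / sqrt (exp (2 * gap p q L (L * t)) - 1) \<le> L / (2 * sqrt (t * (1 - t)) * L / sqrt C)"
    using assms \<open>C > 0\<close> tt gap_pos[of L p q "L * t"]
    by (intro divide_left_mono mult_pos_pos) (auto intro!: divide_pos_pos mult_pos_pos)
  then show ?thesis using assms by (simp add: Jint_def)
qed

lemma Jint_scaled_absolutely_integrable:
  assumes "L > 0" "p < q"
  shows "(\<lambda>t. L * Jint p q L (L * t)) absolutely_integrable_on {0<..<1}"
proof -
  define C where "C = L\<^sup>2 / gap p q L (L / 2)"
  have C: "L\<^sup>2 \<le> C * gap p q L (L / 2)"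
    using gap_half_pos[OF assms] by (simp add: C_def)
  have "continuous_on {0<..<1} (\<lambda>t. L * Jint p q L (L * t))"
    using assms
    by (intro continuous_intros continuous_on_compose2[OF continuous_on_Jint[OF assms]]) auto
  then have "(\<lambda>t. L * Jint p q L (L * t)) \<in> borel_measurable (lebesgue_on {0<..<1})"
    by (intro continuous_imp_measurable_on_sets_lebesgue) auto
  then show ?thesis
    using Jint_le[OF assms _ _ C] Jint_nonneg[OF assms] assms
    by (intro measurable_bounded_by_integrable_imp_absolutely_integrable
        [where g = "\<lambda>t. sqrt C / 2 * (1 / sqrt (t * (1 - t)))"])
      (auto intro!: integrable_on_mult_right has_integral_integrable[OF has_integral_inverse_sqrt_parabola]
        simp del: times_divide_eq_right)
qed

text \<open>The substitution \<open>x = exp (L * t)\<close> moves the integral to an interval that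
  does not depend on \<open>r\<close>. Absolute integrability licenses the change of variables and
  later the cutting of the interval.\<close>

lemma Theta_exp:
  assumes "L > 0" "p < q"
  shows "Theta_integrand p q (exp L) absolutely_integrable_on {1<..<exp L}"
    and "Theta p q (exp L) = integral {0<..<1} (\<lambda>t. L * Jint p q L (L * t))"
proof -
  let ?f = "Theta_integrand p q (exp L)" and ?g = "\<lambda>t. exp (L * t)"
  have img: "?g ` {0<..<1} = {1<..<exp L}"
  proof (intro equalityI subsetI)
    fix x assume "x \<in> {1<..<exp L}"
    then have "x > 0" "0 < ln x" "ln x < ln (exp L)" using assms by (auto simp del: ln_exp)
    then have "ln x / L \<in> {0<..<1}" "x = exp (L * (ln x / L))"
      using assms by (auto simp: field_simps)
    then show "x \<in> ?g ` {0<..<1}" by blast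
  qed (use assms in auto)
  have inj: "inj_on ?g {0<..<1}" using assms by (auto simp: inj_on_def)
  have der: "(?g has_real_derivative L * exp (L * t)) (at t within {0<..<1})" for t
    by (auto intro!: derivative_eq_intros)
  have eq: "\<bar>L * exp (L * t)\<bar> * ?f (?g t) = L * Jint p q L (L * t)" if "t \<in> {0<..<1}" for t
  proof -
    have "?f (?g t) = exp (- (L * t)) * Jint p q L (L * t)"
      using assms that by (intro Theta_integrand_exp) auto
    then show ?thesis using assms by (simp add: abs_mult exp_minus)
  qed
  have "(\<lambda>t. \<bar>L * exp (L * t)\<bar> * ?f (?g t)) absolutely_integrable_on {0<..<1}"
    using Jint_scaled_absolutely_integrable[OF assms] by (rule absolutely_integrable_spike[where S="{}"]) (use eq in auto)
  moreover have "integral {0<..<1} (\<lambda>t. \<bar>L * exp (L * t)\<bar> * ?f (?g t))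
      = integral {0<..<1} (\<lambda>t. L * Jint p q L (L * t))"
    by (intro integral_cong eq) auto
  ultimately have "?f absolutely_integrable_on {1<..<exp L} \<and>
      integral {1<..<exp L} ?f = integral {0<..<1} (\<lambda>t. L * Jint p q L (L * t))"
    using has_absolute_integral_change_of_variables_1'[OF _ der inj, of ?f] img by auto
  then show "?f absolutely_integrable_on {1<..<exp L}"
    and "Theta p q (exp L) = integral {0<..<1} (\<lambda>t. L * Jint p q L (L * t))"
    by (simp_all add: Theta_def integral_open_interval_real)
qed

text \<open>The common engine for continuity and for all limits except
  \<open>r \<rightarrow> \<infinity>\<close>. It is phrased along a sequence because dominated
  convergence is; the filter \<open>F\<close> covers the different limit processes.\<close>

lemma tendsto_Theta_along:
  fixes p q L :: "'a \<Rightarrow> real"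
  assumes X: "filterlim X F sequentially"
    and ev: "\<forall>\<^sub>F x in F. p x < q x" "\<forall>\<^sub>F x in F. L x > 0"
    and bnd: "((\<lambda>x. (L x)\<^sup>2 / gap (p x) (q x) (L x) (L x / 2)) \<longlongrightarrow> c) F"
    and lim: "\<And>t. 0 < t \<Longrightarrow> t < 1 \<Longrightarrow> ((\<lambda>x. L x * Jint (p x) (q x) (L x) (L x * t)) \<longlongrightarrow> h t) F"
    and I: "(h has_integral I) {0<..<1}"
  shows "(\<lambda>n. Theta (p (X n)) (q (X n)) (exp (L (X n)))) \<longlonglongrightarrow> I"
proof -
  \<comment> \<open>Any number above the limit \<open>c\<close> eventually bounds the
    quotient.\<close>
  define C where "C = c + 1"
  have "\<forall>\<^sub>F x in F. (L x)\<^sup>2 / gap (p x) (q x) (L x) (L x / 2) < C"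
    by (rule order_tendstoD[OF bnd]) (simp add: C_def)
  with ev have "\<forall>\<^sub>F x in F. p x < q x \<and> L x > 0 \<and> (L x)\<^sup>2 \<le> C * gap (p x) (q x) (L x) (L x / 2)"
  proof eventually_elim
    case (elim x)
    then show ?case using gap_half_pos[of "L x" "p x" "q x"] by (auto simp: field_simps)
  qed
  with X have "\<forall>\<^sub>F n in sequentially. p (X n) < q (X n) \<and> L (X n) > 0 \<and>
      (L (X n))\<^sup>2 \<le> C * gap (p (X n)) (q (X n)) (L (X n)) (L (X n) / 2)"
    using filterlim_iff by blast
  then obtain N where N: "p (X n) < q (X n)" "L (X n) > 0"
      "(L (X n))\<^sup>2 \<le> C * gap (p (X n)) (q (X n)) (L (X n)) (L (X n) / 2)" if "n \<ge> N" for n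
    by (auto simp: eventually_sequentially)
  \<comment> \<open>The shift by \<open>N\<close> makes the domination hold for every
    \<open>n\<close>; \<open>LIMSEQ_offset\<close> undoes it.\<close>
  define f where "f n t = (let x = X (n + N) in L x * Jint (p x) (q x) (L x) (L x * t))" for n t
  have "(\<lambda>n. integral {0<..<1} (f n)) \<longlonglongrightarrow> integral {0<..<1} h"
  proof (rule dominated_convergence(2)[where h = "\<lambda>t. sqrt C / 2 * (1 / sqrt (t * (1 - t)))"])
    show "f n integrable_on {0<..<1}" for n
      using Jint_scaled_absolutely_integrable[OF N(2,1), of "n + N"]
      by (simp add: f_def[abs_def] Let_def absolutely_integrable_on_def)
    show "(\<lambda>t. sqrt C / 2 * (1 / sqrt (t * (1 - t)))) integrable_on {0<..<1}"
      by (intro integrable_on_mult_right has_integral_integrable[OF has_integral_inverse_sqrt_parabola])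
    show "norm (f n t) \<le> sqrt C / 2 * (1 / sqrt (t * (1 - t)))" if "t \<in> {0<..<1}" for n t
      using Jint_le[OF N(2,1) _ _ N(3), of "n + N" t] Jint_nonneg[OF N(2,1), of "n + N"] that
        N(2)[of "n + N"] by (simp add: f_def Let_def)
    show "(\<lambda>n. f n t) \<longlonglongrightarrow> h t" if "t \<in> {0<..<1}" for t
      unfolding f_def Let_def
      by (rule LIMSEQ_ignore_initial_segment, rule filterlim_compose[OF lim X]) (use that in auto)
  qed
  moreover have "integral {0<..<1} (f n) = Theta (p (X (n + N))) (q (X (n + N))) (exp (L (X (n + N))))" for n
    using Theta_exp(2)[OF N(2,1), of "n + N"] by (simp add: f_def[abs_def] Let_def)
  ultimately have "(\<lambda>n. Theta (p (X (n + N))) (q (X (n + N))) (exp (L (X (n + N))))) \<longlonglongrightarrow> I"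
    using I by (simp add: integral_unique)
  then show ?thesis by (rule LIMSEQ_offset)
qed

section \<open>Large \<open>r\<close>\<close>

text \<open>For \<open>p < 0\<close> both values of \<open>pint\<close> have the same finite limit,
  for \<open>p = 0\<close> they are \<open>L - w\<close> and \<open>L\<close>, and for
  \<open>p > 0\<close> the leading exponentials have ratio \<open>exp (- (p * w))\<close>;
  \<open>max 0 p\<close> unites the cases.\<close>

lemma pint_ratio_at_top:
  "((\<lambda>L. pint p (L - w) / pint p L) \<longlongrightarrow> exp (- (max 0 p * w))) at_top"
proof -
  consider "p < 0" | "p = 0" | "p > 0" by linarith
  then show ?thesis
  proof cases
    case 1
    have lim: "((\<lambda>L. exp (p * (L - a))) \<longlongrightarrow> 0) at_top" for a
      using 1 by real_asymp
    have "((\<lambda>L. (exp (p * (L - w)) - 1) / (exp (p * (L - 0)) - 1)) \<longlongrightarrow> (0 - 1) / (0 - 1)) at_top"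
      by (intro tendsto_intros lim) auto
    then show ?thesis using 1 by (simp add: pint_eq)
  next
    case 2
    have "((\<lambda>L::real. (L - w) / L) \<longlongrightarrow> 1) at_top" by real_asymp
    then show ?thesis using 2 by simp
  next
    case 3
    have lim: "((\<lambda>L. exp (- p * L)) \<longlongrightarrow> 0) at_top"
      using 3 by real_asymp
    have "((\<lambda>L. (exp (- (p * w)) - exp (- p * L)) / (1 - exp (- p * L))) \<longlongrightarrow> (exp (- (p * w)) - 0) / (1 - 0)) at_top"
      by (intro tendsto_intros lim) auto
    moreover have "\<forall>\<^sub>F L in at_top. (exp (- (p * w)) - exp (- p * L)) / (1 - exp (- p * L))
        = pint p (L - w) / pint p L"
      using eventually_gt_at_top[of 0]
    proof eventually_elim
      case (elim L)
      have "exp (p * L) > 1" using 3 elim by simp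
      moreover have "exp (p * (L - w)) = exp (p * L) * exp (- (p * w))"
        by (simp add: right_diff_distrib' flip: exp_add)
      ultimately show ?case using 3 by (simp add: pint_eq exp_minus divide_simps) (simp add: algebra_simps)
    qed
    ultimately show ?thesis using 3 by (simp add: Lim_transform_eventually)
  qed
qed

text \<open>This isolates the ratio of \<open>pint\<close> values, whose limits and midpoint value
  are known, from the dependence on \<open>q\<close>.\<close>

lemma gap_eq:
  assumes "q \<noteq> 0"
  shows "gap p q L v = ln (1 + pint p v / pint p L * (exp (q * L) - 1)) / q - v"
proof -
  have "q * (pint q L / pint p L * pint p v) = pint p v / pint p L * (q * pint q L)" by simp
  then have "1 + q * (pint q L / pint p L * pint p v) = 1 + pint p v / pint p L * (exp (q * L) - 1)"
    by (simp only: mult_pint)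
  then show ?thesis unfolding gap_def interp_def pinv_eq[OF assms] by (simp only:)
qed

text \<open>Taking \<open>exp (q * L)\<close> out of the logarithm cancels \<open>L\<close>; what
  remains inside tends to the limit of the ratio in \<open>pint_ratio_at_top\<close>.\<close>

lemma gap_from_end_at_top:
  assumes "q > 0"
  shows "((\<lambda>L. gap p q L (L - w)) \<longlongrightarrow> (1 - max 0 p / q) * w) at_top"
proof -
  let ?R = "\<lambda>L. pint p (L - w) / pint p L"
  have lim: "((\<lambda>L. exp (- q * L)) \<longlongrightarrow> 0) at_top"
    using assms by real_asymp
  have lim_arg: "((\<lambda>L. exp (- q * L) + ?R L * (1 - exp (- q * L))) \<longlongrightarrow> 0 + exp (- (max 0 p * w)) * (1 - 0)) at_top"
    by (intro tendsto_intros lim pint_ratio_at_top)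
  then have "((\<lambda>L. ln (exp (- q * L) + ?R L * (1 - exp (- q * L))) / q + w) \<longlongrightarrow>
      ln (0 + exp (- (max 0 p * w)) * (1 - 0)) / q + w) at_top"
    using assms by (intro tendsto_add tendsto_divide tendsto_ln[OF lim_arg] tendsto_const) auto
  moreover have "\<forall>\<^sub>F L in at_top. exp (- q * L) + ?R L * (1 - exp (- q * L)) > 0"
    by (rule order_tendstoD[OF lim_arg]) simp
  then have "\<forall>\<^sub>F L in at_top. ln (exp (- q * L) + ?R L * (1 - exp (- q * L))) / q + w = gap p q L (L - w)"
  proof eventually_elim
    case (elim L)
    have "1 + ?R L * (exp (q * L) - 1) = exp (q * L) * (exp (- q * L) + ?R L * (1 - exp (- q * L)))"
      by (simp add: exp_minus algebra_simps)
    then have "ln (1 + ?R L * (exp (q * L) - 1)) = q * L + ln (exp (- q * L) + ?R L * (1 - exp (- q * L)))"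
      using elim by (simp add: ln_mult)
    then show ?case using assms by (simp add: gap_eq add_divide_distrib)
  qed
  ultimately have "((\<lambda>L. gap p q L (L - w)) \<longlongrightarrow> ln (0 + exp (- (max 0 p * w)) * (1 - 0)) / q + w) at_top"
    by (rule Lim_transform_eventually)
  then show ?thesis by (simp add: algebra_simps)
qed

text \<open>Since \<open>q > max 0 p\<close>, \<open>exp (q * L)\<close> outgrows
  \<open>pint p L\<close>, which is bounded, linear or of order \<open>exp (p * L)\<close> according
  to the sign of \<open>p\<close>. This is why the left half contributes nothing in the
  limit.\<close>

lemma gap_from_start_at_top:
  assumes "q > 0" "p < q" "v > 0"
  shows "filterlim (\<lambda>L. gap p q L v) at_top at_top"
proof -
  have *: "filterlim (\<lambda>L. (exp (q * L) - 1) / pint p L) at_top at_top"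
  proof -
    consider "p < 0" | "p = 0" | "p > 0" by linarith
    then show ?thesis
    proof cases
      case 1
      have lim: "((\<lambda>L. exp (p * L)) \<longlongrightarrow> 0) at_top" using 1 by real_asymp
      have "((\<lambda>L. p / (exp (p * L) - 1)) \<longlongrightarrow> p / (0 - 1)) at_top"
        by (intro tendsto_intros lim) auto
      moreover have "filterlim (\<lambda>L. exp (q * L) - 1) at_top at_top" using assms(1) by real_asymp
      ultimately have "filterlim (\<lambda>L. p / (exp (p * L) - 1) * (exp (q * L) - 1)) at_top at_top"
        using 1 by (intro filterlim_tendsto_pos_mult_at_top) auto
      then show ?thesis using 1 by (simp add: pint_eq mult.commute)
    next
      case 2
      have "filterlim (\<lambda>L. (exp (q * L) - 1) / L) at_top at_top" using assms(1) by real_asymp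
      then show ?thesis using 2 by simp
    next
      case 3
      have "filterlim (\<lambda>L. (exp (q * L) - 1) / ((exp (p * L) - 1) / p)) at_top at_top"
        using assms(2) 3 by real_asymp
      then show ?thesis using 3 by (simp add: pint_eq)
    qed
  qed
  have "filterlim (\<lambda>L. 1 + pint p v * ((exp (q * L) - 1) / pint p L)) at_top at_top"
    by (intro filterlim_tendsto_add_at_top[OF tendsto_const]
        filterlim_tendsto_pos_mult_at_top[OF tendsto_const _ *] pint_pos assms)
  then have "filterlim (\<lambda>L. ln (1 + pint p v * ((exp (q * L) - 1) / pint p L))) at_top at_top"
    by (rule filterlim_compose[OF ln_at_top])
  then have "filterlim (\<lambda>L. - v + 1 / q * ln (1 + pint p v * ((exp (q * L) - 1) / pint p L))) at_top at_top"
    using assms by (intro filterlim_tendsto_add_at_top[OF tendsto_const]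
        filterlim_tendsto_pos_mult_at_top[OF tendsto_const]) auto
  then show ?thesis using assms by (simp add: gap_eq)
qed

text \<open>With \<open>m = max 0 p\<close> the midpoint value is at least
  \<open>(1 - m / q) * (L / 2) - ln 2 / q\<close>; a slope \<open>c\<close> strictly below
  \<open>1 - m / q\<close> absorbs the constant for large \<open>L\<close>.\<close>

lemma gap_half_ge_at_top:
  assumes "q > 0" "p < q" and c: "c < 1 - max 0 p / q"
  shows "\<forall>\<^sub>F L in at_top. gap p q L (L / 2) \<ge> c * (L / 2)"
proof -
  define m where "m = max 0 p"
  have "filterlim (\<lambda>L. (1 - m / q - c) * (L / 2)) at_top at_top"
    using c assms(1) by (intro filterlim_tendsto_pos_mult_at_top[OF tendsto_const]) (auto simp: m_def, real_asymp)
  then have "\<forall>\<^sub>F L in at_top. (1 - m / q - c) * (L / 2) \<ge> ln 2 / q"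
    unfolding filterlim_at_top by (rule spec)
  with eventually_gt_at_top[of 0] show ?thesis
  proof eventually_elim
    case (elim L)
    define X where "X = exp (p * L / 2) + 1"
    \<comment> \<open>Both summands of \<open>X\<close> are at most \<open>exp (m * L / 2)\<close>;
      this is the origin of \<open>ln 2\<close>.\<close>
    have X: "1 \<le> X" "X \<le> 2 * exp (m * L / 2)"
    proof -
      have "exp (p * L / 2) \<le> exp (m * L / 2)" "1 \<le> exp (m * L / 2)"
        using elim(1) by (auto simp: m_def intro!: mult_right_mono)
      then show "X \<le> 2 * exp (m * L / 2)" unfolding X_def by linarith
    qed (simp add: X_def)
    have "exp (q * L) / (2 * exp (m * L / 2)) \<le> exp (q * L) / X"
      using X by (intro divide_left_mono) auto
    also have "\<dots> \<le> 1 + 1 / X * (exp (q * L) - 1)"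
      using X by (simp add: field_simps)
    finally have "ln (exp (q * L) / (2 * exp (m * L / 2))) \<le> ln (1 + 1 / X * (exp (q * L) - 1))"
      by (subst ln_le_cancel_iff) (auto intro: less_le_trans[rotated])
    then have "(q * L - ln 2 - m * L / 2) / q \<le> ln (1 + 1 / X * (exp (q * L) - 1)) / q"
      using assms(1) by (intro divide_right_mono) (auto simp: ln_div ln_mult)
    moreover have "(q * L - ln 2 - m * L / 2) / q = L - ln 2 / q - m / q * (L / 2)"
      using assms(1) by (simp add: field_simps)
    moreover have "gap p q L (L / 2) = ln (1 + 1 / X * (exp (q * L) - 1)) / q - L / 2"
      using assms(1) elim(1) pint_half[of L p] by (simp add: gap_eq X_def)
    moreover have "(1 - m / q - c) * (L / 2) = L / 2 - m / q * (L / 2) - c * (L / 2)"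
      by (simp only: left_diff_distrib mult_1)
    ultimately show ?case using elim(2) by linarith
  qed
qed

text \<open>The left half is substituted by \<open>y = 1 / x\<close>, the right one by
  \<open>y = x / r\<close>. In both, \<open>- ln y\<close> is the distance of \<open>v\<close> to
  the nearer end of \<open>[0, L]\<close>, and the domain is the same set \<open>S\<close>.\<close>

lemma Theta_exp_split:
  fixes p q L :: real
  defines "S \<equiv> {exp (- (L / 2))<..<1}"
  assumes "L > 0" "p < q"
  shows "(\<lambda>y. 1 / y * Jint p q L (- ln y)) integrable_on S"
    and "(\<lambda>y. 1 / y * Jint p q L (L + ln y)) integrable_on S"
    and "Theta p q (exp L) = integral S (\<lambda>y. 1 / y * Jint p q L (- ln y))
      + integral S (\<lambda>y. 1 / y * Jint p q L (L + ln y))"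
proof -
  let ?f = "Theta_integrand p q (exp L)"
  have cong: "k integrable_on S \<and> integral S k = b"
    if "h absolutely_integrable_on S \<and> integral S h = b" "\<And>y. y \<in> S \<Longrightarrow> h y = k y"
    for h k :: "real \<Rightarrow> real" and b
    using that integrable_eq[of h S k] integral_cong[of S h k] by (auto simp: absolutely_integrable_on_def)
  have S: "0 < y" "y < 1" "- (L / 2) < ln y" "ln y < 0" if "y \<in> S" for y
  proof -
    have "exp (- (L / 2)) < y" "y < 1" using that by (auto simp: S_def)
    moreover from this show "0 < y" using exp_gt_zero[of "- (L / 2)"] by linarith
    ultimately have "ln (exp (- (L / 2))) < ln y" by (subst ln_less_cancel_iff) auto
    then show "- (L / 2) < ln y" by simp
    show "y < 1" "ln y < 0" using \<open>0 < y\<close> \<open>y < 1\<close> by auto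
  qed
  have e: "exp (- (L / 2)) = 1 / exp (L / 2)" by (simp add: exp_minus field_simps)
  have int: "?f absolutely_integrable_on {1<..<exp L}"
    by (rule Theta_exp(1)[OF assms(2,3)])
  have half: "1 < exp (L / 2)" "exp (L / 2) < exp L" using assms by auto
  have int1: "?f absolutely_integrable_on {1<..<exp (L / 2)}"
    and int2: "?f absolutely_integrable_on {exp (L / 2)<..<exp L}"
    using less_trans[OF _ half(2)] less_trans[OF half(1)]
    by (auto intro!: set_integrable_subset[OF int])
  have "(\<lambda>y. \<bar>- (1 / y\<^sup>2)\<bar> * ?f (1 / y)) absolutely_integrable_on S \<and>
      integral S (\<lambda>y. \<bar>- (1 / y\<^sup>2)\<bar> * ?f (1 / y)) = integral {1<..<exp (L / 2)} ?f"
  proof -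
    have img: "(\<lambda>y. 1 / y) ` S = {1<..<exp (L / 2)}"
    proof (intro equalityI subsetI)
      fix x assume x: "x \<in> {1<..<exp (L / 2)}"
      then have "1 / exp (L / 2) < 1 / x" "1 / x < 1" by (auto intro!: divide_strict_left_mono)
      then have "1 / x \<in> S" by (simp only: S_def e greaterThanLessThan_iff)
      then show "x \<in> (\<lambda>y. 1 / y) ` S" using x by (intro image_eqI[where x = "1 / x"]) auto
    qed (use S in \<open>auto simp: S_def e field_simps\<close>)
    have der: "((\<lambda>y. 1 / y) has_real_derivative - (1 / y\<^sup>2)) (at y within S)" if "y \<in> S" for y
      using S(1)[OF that] by (auto intro!: derivative_eq_intros simp: power2_eq_square)
    have inj: "inj_on (\<lambda>y. 1 / y) S" by (auto intro: inj_onI)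
    have leb: "S \<in> sets lebesgue" by (simp add: S_def)
    show ?thesis
      using has_absolute_integral_change_of_variables_1'[OF leb der inj, of ?f] int1 unfolding img by blast
  qed
  moreover have "\<bar>- (1 / y\<^sup>2)\<bar> * ?f (1 / y) = 1 / y * Jint p q L (- ln y)" if "y \<in> S" for y
  proof -
    have "?f (exp (- ln y)) = exp (- (- ln y)) * Jint p q L (- ln y)"
      using S[OF that] assms by (intro Theta_integrand_exp) auto
    then show ?thesis using S[OF that] by (simp add: exp_minus inverse_eq_divide power2_eq_square)
  qed
  ultimately have 1: "(\<lambda>y. 1 / y * Jint p q L (- ln y)) integrable_on S \<and>
      integral S (\<lambda>y. 1 / y * Jint p q L (- ln y)) = integral {1<..<exp (L / 2)} ?f"
    by (rule cong)
  have "(\<lambda>y. \<bar>exp L\<bar> * ?f (exp L * y)) absolutely_integrable_on S \<and>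
      integral S (\<lambda>y. \<bar>exp L\<bar> * ?f (exp L * y)) = integral {exp (L / 2)<..<exp L} ?f"
  proof -
    have e2: "exp (L / 2) = exp L * exp (- (L / 2))" by (simp flip: exp_add)
    have img: "(\<lambda>y. exp L * y) ` S = {exp (L / 2)<..<exp L}"
    proof (intro equalityI subsetI)
      fix x assume x: "x \<in> {exp (L / 2)<..<exp L}"
      then have "x / exp L \<in> S" by (auto simp: S_def e2 field_simps)
      then show "x \<in> (\<lambda>y. exp L * y) ` S" by (intro image_eqI[where x = "x / exp L"]) auto
    qed (auto simp: S_def e2)
    have der: "((\<lambda>y. exp L * y) has_real_derivative exp L) (at y within S)" for y
      by (auto intro!: derivative_eq_intros)
    have inj: "inj_on (\<lambda>y. exp L * y) S" by (auto intro: inj_onI)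
    have leb: "S \<in> sets lebesgue" by (simp add: S_def)
    show ?thesis
      using has_absolute_integral_change_of_variables_1'[OF leb der inj, of ?f] int2 unfolding img by blast
  qed
  moreover have "\<bar>exp L\<bar> * ?f (exp L * y) = 1 / y * Jint p q L (L + ln y)" if "y \<in> S" for y
  proof -
    have "?f (exp (L + ln y)) = exp (- (L + ln y)) * Jint p q L (L + ln y)"
      using S[OF that] assms by (intro Theta_integrand_exp) auto
    then show ?thesis using S[OF that] by (simp add: exp_add exp_minus exp_diff field_simps)
  qed
  ultimately have 2: "(\<lambda>y. 1 / y * Jint p q L (L + ln y)) integrable_on S \<and>
      integral S (\<lambda>y. 1 / y * Jint p q L (L + ln y)) = integral {exp (L / 2)<..<exp L} ?f"
    by (rule cong)
  have "?f integrable_on {1..exp L}"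
    using int by (simp add: absolutely_integrable_on_def integrable_on_Icc_iff_Ioo)
  then have "Theta p q (exp L) = integral {1<..<exp (L / 2)} ?f + integral {exp (L / 2)<..<exp L} ?f"
    using half Henstock_Kurzweil_Integration.integral_combine[of 1 "exp (L / 2)" "exp L" ?f]
    by (simp add: Theta_def integral_open_interval_real)
  with 1 2 show "(\<lambda>y. 1 / y * Jint p q L (- ln y)) integrable_on S"
    "(\<lambda>y. 1 / y * Jint p q L (L + ln y)) integrable_on S"
    "Theta p q (exp L) = integral S (\<lambda>y. 1 / y * Jint p q L (- ln y))
      + integral S (\<lambda>y. 1 / y * Jint p q L (L + ln y))"
    by simp_all
qed

lemma Jint_le_of_gap_ge: "Jint p q L v \<le> 1 / sqrt (exp (2 * a) - 1)" if "0 < a" "a \<le> gap p q L v"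
  using that by (auto simp: Jint_def intro!: divide_left_mono mult_pos_pos)

lemma tendsto_Theta_at_top:
  assumes "p < q" "0 < q"
  shows "((\<lambda>r. Theta p q r) \<longlongrightarrow> pi / (2 * (1 - max 0 p / q))) at_top"
proof (rule tendsto_at_topI_sequentially)
  fix X :: "nat \<Rightarrow> real" assume X: "filterlim X at_top sequentially"
  define c where "c = 1 - max 0 p / q"
  \<comment> \<open>Any slope strictly between 0 and \<open>c\<close> serves: below \<open>c\<close>
    the linear bound holds eventually, above 0 the dominating function is integrable.\<close>
  define c' where "c' = c / 2"
  have c: "c > 0" "c' > 0" "c' < c" using assms by (auto simp: c_def c'_def field_simps max_def)
  define L where "L n = ln (X n)" for n
  have L: "filterlim L at_top sequentially"
    unfolding L_def[abs_def] by (rule filterlim_compose[OF ln_at_top X])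
  have "\<forall>\<^sub>F x in at_top. x > 0 \<and> gap p q x (x / 2) \<ge> c' * (x / 2)"
    using gap_half_ge_at_top[of q p c'] assms c eventually_gt_at_top[of 0]
    by (auto simp: c_def intro: eventually_conj)
  then have "\<forall>\<^sub>F n in sequentially. L n > 0 \<and> gap p q (L n) (L n / 2) \<ge> c' * (L n / 2)"
    using L filterlim_iff by blast
  moreover have "\<forall>\<^sub>F n in sequentially. X n > 0"
    using X by (simp add: filterlim_at_top_dense)
  ultimately have "\<forall>\<^sub>F n in sequentially. (L n > 0 \<and> gap p q (L n) (L n / 2) \<ge> c' * (L n / 2)) \<and> X n > 0"
    by (rule eventually_conj)
  then obtain N where N: "L n > 0" "gap p q (L n) (L n / 2) \<ge> c' * (L n / 2)" "X n > 0" if "n \<ge> N" for n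
    by (auto simp: eventually_sequentially)
  \<comment> \<open>Dropping the first \<open>N\<close> terms makes positivity and the midpoint
    bound hold for all \<open>n\<close>.\<close>
  define l where "l n = L (n + N)" for n
  have l: "filterlim l at_top sequentially"
    using L unfolding l_def by (rule filterlim_compose) (rule filterlim_add_const_nat_at_top)
  have l_pos: "l n > 0" and gap_half: "gap p q (l n) (l n / 2) \<ge> c' * (l n / 2)" for n
    using N[of "n + N"] by (auto simp: l_def)
  define S where "S n = {exp (- (l n / 2))<..<1}" for n
  have S: "S n \<subseteq> {0<..<1}" for n
    using less_trans[OF exp_gt_zero] by (auto simp: S_def)
  have S_ev: "\<forall>\<^sub>F n in sequentially. y \<in> S n" if "y \<in> {0<..<1}" for y
  proof -
    have "filterlim (\<lambda>n. l n) at_top sequentially" by (rule l)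
    then have "\<forall>\<^sub>F n in sequentially. l n > - 2 * ln y" by (simp add: filterlim_at_top_dense)
    then show ?thesis
    proof eventually_elim
      case (elim n)
      then have "exp (- (l n / 2)) < exp (ln y)" by simp
      also have "exp (ln y) = y" using that by simp
      finally show ?case using that by (simp add: S_def)
    qed
  qed
  define dom where "dom y = 1 / y / sqrt (exp (2 * (c' * - ln y)) - 1)" for y
  have dom: "dom integrable_on {0<..<1}"
    unfolding dom_def using has_integral_inverse_sqrt_powr[OF c(2)] by (rule has_integral_integrable)
  \<comment> \<open>One dominated convergence argument for both halves: \<open>v n y\<close> is the
    point at distance \<open>- ln y\<close> from one end of \<open>[0, l n]\<close>.\<close>
  have lim: "(\<lambda>n. integral (S n) (\<lambda>y. 1 / y * Jint p q (l n) (v n y))) \<longlonglongrightarrow> integral {0<..<1} h"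
    if int: "\<And>n. (\<lambda>y. 1 / y * Jint p q (l n) (v n y)) integrable_on S n"
      and v: "\<And>n y. v n y = - ln y \<or> v n y = l n + ln y"
      and h: "\<And>y. y \<in> {0<..<1} \<Longrightarrow> (\<lambda>n. Jint p q (l n) (v n y)) \<longlonglongrightarrow> y * h y"
    for v h
  proof -
    \<comment> \<open>Extension by 0 replaces the growing domains \<open>S n\<close> by the fixed
      interval \<open>(0, 1)\<close>.\<close>
    define f where "f n y = (if y \<in> S n then 1 / y * Jint p q (l n) (v n y) else 0)" for n y
    have "(f n has_integral integral (S n) (\<lambda>y. 1 / y * Jint p q (l n) (v n y))) {0<..<1}" for n
      unfolding f_def has_integral_restrict[OF S] using int by (rule integrable_integral)
    then have f: "f n integrable_on {0<..<1}"
        "integral {0<..<1} (f n) = integral (S n) (\<lambda>y. 1 / y * Jint p q (l n) (v n y))" for n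
      by (auto simp: has_integral_iff)
    have "(\<lambda>n. integral {0<..<1} (f n)) \<longlonglongrightarrow> integral {0<..<1} h"
    proof (rule dominated_convergence(2)[OF f(1) dom])
      fix n and y :: real assume y: "y \<in> {0<..<1}"
      show "norm (f n y) \<le> dom y"
      proof (cases "y \<in> S n")
        case True
        have "- ln y < l n / 2"
        proof -
          have "ln (exp (- (l n / 2))) < ln y"
            using True y by (subst ln_less_cancel_iff) (auto simp: S_def)
          then show ?thesis by simp
        qed
        moreover have "ln y < 0" using y by simp
        ultimately have vn: "0 < v n y" "v n y < l n" "min (v n y) (l n - v n y) = - ln y"
          using v[of n y] l_pos[of n] by (auto simp: min_def)
        \<comment> \<open>Inserting the midpoint bound into \<open>gap_ge\<close> cancels
          \<open>l n\<close> and leaves a bound independent of \<open>n\<close>.\<close>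
        have "c' * - ln y = 2 / l n * (- ln y) * (c' * (l n / 2))" using l_pos[of n] by simp
        also have "\<dots> \<le> 2 / l n * (- ln y) * gap p q (l n) (l n / 2)"
          using l_pos[of n] \<open>ln y < 0\<close> gap_half by (intro mult_left_mono) (auto intro: divide_nonpos_pos)
        also have "\<dots> \<le> gap p q (l n) (v n y)"
          using gap_ge[of "l n" p q "v n y"] vn l_pos assms by simp
        finally have "Jint p q (l n) (v n y) \<le> 1 / sqrt (exp (2 * (c' * - ln y)) - 1)"
          using c \<open>ln y < 0\<close> by (intro Jint_le_of_gap_ge) (auto simp: mult_pos_neg)
        then have "1 / y * Jint p q (l n) (v n y) \<le> 1 / y * (1 / sqrt (exp (2 * (c' * - ln y)) - 1))"
          using y by (intro mult_left_mono) auto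
        then show ?thesis
          using True y Jint_nonneg[of "l n" p q "v n y"] vn l_pos assms by (simp add: f_def dom_def)
      next
        case False
        then show ?thesis using y c by (auto simp: f_def dom_def mult_nonneg_nonpos intro!: divide_nonneg_nonneg)
      qed
      have "(\<lambda>n. 1 / y * Jint p q (l n) (v n y)) \<longlonglongrightarrow> 1 / y * (y * h y)"
        by (intro tendsto_intros h y)
      moreover have "\<forall>\<^sub>F n in sequentially. 1 / y * Jint p q (l n) (v n y) = f n y"
        using S_ev[OF y] by eventually_elim (simp add: f_def)
      ultimately have "(\<lambda>n. f n y) \<longlonglongrightarrow> 1 / y * (y * h y)"
        by (rule Lim_transform_eventually)
      then show "(\<lambda>n. f n y) \<longlonglongrightarrow> h y" using y by simp
    qed
    then show ?thesis by (simp add: f(2))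
  qed
  \<comment> \<open>Left half: at a fixed distance from 0 the gap diverges, so the integrand tends
    to 0.\<close>
  have "(\<lambda>n. integral (S n) (\<lambda>y. 1 / y * Jint p q (l n) (- ln y))) \<longlonglongrightarrow> integral {0<..<1} (\<lambda>y::real. 0::real)"
  proof (rule lim)
    fix y :: real assume y: "y \<in> {0<..<1}"
    have "filterlim (\<lambda>n. gap p q (l n) (- ln y)) at_top sequentially"
      using y assms by (intro filterlim_compose[OF gap_from_start_at_top l]) auto
    moreover have "((\<lambda>x::real. 1 / sqrt (exp (2 * x) - 1)) \<longlongrightarrow> 0) at_top" by real_asymp
    ultimately show "(\<lambda>n. Jint p q (l n) (- ln y)) \<longlonglongrightarrow> y * 0"
      unfolding Jint_def mult_zero_right by (rule filterlim_compose[rotated])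
  qed (use Theta_exp_split(1)[OF l_pos assms(1)] in \<open>auto simp: S_def\<close>)
  \<comment> \<open>Right half: at distance \<open>- ln y\<close> from \<open>l n\<close> the gap
    tends to \<open>c * - ln y\<close>.\<close>
  moreover have "(\<lambda>n. integral (S n) (\<lambda>y. 1 / y * Jint p q (l n) (l n + ln y))) \<longlonglongrightarrow>
      integral {0<..<1} (\<lambda>y. 1 / y / sqrt (exp (2 * (c * - ln y)) - 1))"
  proof (rule lim)
    fix y :: real assume y: "y \<in> {0<..<1}"
    then have "c * - ln y > 0" using c by (simp add: mult_pos_neg)
    have "(\<lambda>n. gap p q (l n) (l n - (- ln y))) \<longlonglongrightarrow> c * - ln y"
      unfolding c_def by (rule filterlim_compose[OF gap_from_end_at_top l]) (rule assms)
    then have "(\<lambda>n. Jint p q (l n) (l n - (- ln y))) \<longlonglongrightarrow> 1 / sqrt (exp (2 * (c * - ln y)) - 1)"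
      unfolding Jint_def using \<open>c * - ln y > 0\<close> by (intro tendsto_intros) auto
    then show "(\<lambda>n. Jint p q (l n) (l n + ln y)) \<longlonglongrightarrow> y * (1 / y / sqrt (exp (2 * (c * - ln y)) - 1))"
      using y by simp
  qed (use Theta_exp_split(2)[OF l_pos assms(1)] in \<open>auto simp: S_def\<close>)
  ultimately have "(\<lambda>n. Theta p q (exp (l n))) \<longlonglongrightarrow> 0 + pi / (2 * c)"
    unfolding Theta_exp_split(3)[OF l_pos assms(1)] S_def
      integral_unique[OF has_integral_inverse_sqrt_powr[OF c(1)]]
    by (intro tendsto_add) auto
  moreover have "exp (l n) = X (n + N)" for n
    using N(3)[of "n + N"] by (simp add: l_def L_def)
  ultimately have "(\<lambda>n. Theta p q (X (n + N))) \<longlonglongrightarrow> pi / (2 * c)" by simp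
  then show "(\<lambda>n. Theta p q (X n)) \<longlonglongrightarrow> pi / (2 * (1 - max 0 p / q))"
    unfolding c_def by (rule LIMSEQ_offset)
qed

section \<open>Continuity and the remaining limits\<close>

lemma tendsto_gap:
  assumes "(f \<longlongrightarrow> p) F" "(g \<longlongrightarrow> q) F" "(l \<longlongrightarrow> L) F" "(v \<longlongrightarrow> w) F"
    and "L > 0" "0 \<le> w" "w \<le> L"
  shows "((\<lambda>x. gap (f x) (g x) (l x) (v x)) \<longlongrightarrow> gap p q L w) F"
  unfolding gap_def interp_def
  by (intro tendsto_intros tendsto_pinv assms interp_arg_pos) (use pint_pos[of L p] assms in auto)

lemma tendsto_inverse_sqrt_exp:
  fixes f :: "'a \<Rightarrow> real"
  assumes "(f \<longlongrightarrow> a) F" "a > 0"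
  shows "((\<lambda>x. 1 / sqrt (exp (2 * f x) - 1)) \<longlongrightarrow> 1 / sqrt (exp (2 * a) - 1)) F"
  using assms by (intro tendsto_intros) auto

text \<open>In the coordinates \<open>p\<close>, \<open>q\<close> and \<open>L = ln r\<close> the
  hypotheses of \<open>tendsto_Theta_along\<close> follow from the joint continuity of
  \<open>gap\<close>, positive in the interior; the limit integrand is the integrand at the limit
  point.\<close>

lemma continuous_on_Theta: "continuous_on {(p, q, r). p < q \<and> 1 < r} (\<lambda>(p, q, r). Theta p q r)"
  unfolding continuous_on_def
proof
  let ?A = "{(p, q, r). p < q \<and> 1 < r} :: (real \<times> real \<times> real) set"
  fix x :: "real \<times> real \<times> real" assume "x \<in> ?A"
  then obtain p q r where x: "x = (p, q, r)" and pq: "p < q" and r: "r > 1" by auto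
  define L where "L = ln r"
  have L: "L > 0" "r = exp L" using r by (simp_all add: L_def)
  let ?F = "at x within ?A"
  have id: "((\<lambda>y. y) \<longlongrightarrow> x) ?F" by (rule tendsto_ident_at)
  have lims: "(fst \<longlongrightarrow> p) ?F" "((\<lambda>y. fst (snd y)) \<longlongrightarrow> q) ?F" "((\<lambda>y. ln (snd (snd y))) \<longlongrightarrow> L) ?F"
    using tendsto_fst[OF id] tendsto_fst[OF tendsto_snd[OF id]]
      tendsto_ln[OF tendsto_snd[OF tendsto_snd[OF id]]] r by (simp_all add: x L_def)
  have in_A: "\<forall>\<^sub>F y in ?F. y \<in> ?A" by (simp add: eventually_at_filter)
  show "((\<lambda>(p, q, r). Theta p q r) \<longlongrightarrow> (case x of (p, q, r) \<Rightarrow> Theta p q r)) ?F"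
    unfolding tendsto_at_iff_sequentially
  proof (intro allI impI)
    fix X assume X: "\<forall>i. X i \<in> ?A - {x}" "X \<longlonglongrightarrow> x"
    then have X': "filterlim X ?F sequentially" by (auto simp: filterlim_at)
    have "(\<lambda>n. Theta (fst (X n)) (fst (snd (X n))) (exp (ln (snd (snd (X n)))))) \<longlonglongrightarrow> Theta p q r"
    proof (rule tendsto_Theta_along[OF X'])
      show "\<forall>\<^sub>F y in ?F. fst y < fst (snd y)" "\<forall>\<^sub>F y in ?F. ln (snd (snd y)) > 0"
        using in_A by (auto elim!: eventually_mono)
      show "((\<lambda>y. (ln (snd (snd y)))\<^sup>2 / gap (fst y) (fst (snd y)) (ln (snd (snd y))) (ln (snd (snd y)) / 2))
          \<longlongrightarrow> L\<^sup>2 / gap p q L (L / 2)) ?F"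
        using gap_half_pos[OF L(1) pq] L(1) by (intro tendsto_intros tendsto_gap lims) auto
      show "((\<lambda>y. ln (snd (snd y)) * Jint (fst y) (fst (snd y)) (ln (snd (snd y))) (ln (snd (snd y)) * t))
          \<longlongrightarrow> L * Jint p q L (L * t)) ?F" if "0 < t" "t < 1" for t
        unfolding Jint_def using L(1) pq that
        by (intro tendsto_intros tendsto_inverse_sqrt_exp tendsto_gap lims gap_pos) auto
      show "((\<lambda>t. L * Jint p q L (L * t)) has_integral Theta p q r) {0<..<1}"
        using Theta_exp(2)[OF L(1) pq] Jint_scaled_absolutely_integrable[OF L(1) pq] L(2)
        by (simp add: absolutely_integrable_on_def has_integral_iff)
    qed
    moreover have "exp (ln (snd (snd (X n)))) = snd (snd (X n))" for n
      using spec[OF X(1), of n] by (auto simp: case_prod_unfold)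
    ultimately show "((\<lambda>(p, q, r). Theta p q r) \<circ> X) \<longlonglongrightarrow> (case x of (p, q, r) \<Rightarrow> Theta p q r)"
      by (simp add: x o_def case_prod_unfold)
  qed
qed

text \<open>If \<open>interp\<close> is replaced by the constant \<open>L\<close>, the original
  integrand becomes \<open>1 / sqrt (r\<^sup>2 - x\<^sup>2)\<close>. Its antiderivative is
  \<open>arcsin (x / r)\<close>, and here \<open>x / r = exp (L * t - L)\<close>.\<close>

lemma has_integral_limit_profile:
  assumes "L > 0"
  shows "((\<lambda>t. L * (1 / sqrt (exp (2 * (L - L * t)) - 1))) has_integral arccos (1 / exp L)) {0<..<1}"
proof -
  have "((\<lambda>t. L * (1 / sqrt (exp (2 * (L - L * t)) - 1))) has_integral
      arcsin (exp (L * 1 - L)) - arcsin (exp (L * 0 - L))) {0<..<1}"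
  proof (rule has_integral_arcsin_comp[where h' = "\<lambda>t. L * exp (L * t - L)"])
    fix t :: real assume t: "0 < t" "t < 1"
    have "exp (2 * (L - L * t)) - 1 = (1 - (exp (L * t - L))\<^sup>2) / (exp (L * t - L))\<^sup>2"
      by (simp add: diff_divide_distrib power2_eq_square flip: exp_add exp_diff) (simp add: algebra_simps flip: exp_minus inverse_eq_divide)
    then show "L * (1 / sqrt (exp (2 * (L - L * t)) - 1)) = L * exp (L * t - L) / sqrt (1 - (exp (L * t - L))\<^sup>2)"
      by (simp add: real_sqrt_divide)
  qed (use assms in \<open>auto intro!: continuous_intros derivative_eq_intros mult_left_le\<close>)
  moreover have "arccos (1 / exp L) = pi / 2 - arcsin (exp (- L))"
    using assms by (subst arccos_arcsin_eq) (auto simp: exp_minus inverse_eq_divide abs_le_iff intro: order_trans[of _ 0])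
  ultimately show ?thesis by simp
qed

text \<open>Serves both \<open>p \<rightarrow> - \<infinity>\<close> and
  \<open>q \<rightarrow> \<infinity>\<close>: either limit pushes \<open>interp\<close> up to the
  constant \<open>L\<close> in the interior.\<close>

lemma tendsto_Theta_profile:
  fixes p q :: "real \<Rightarrow> real"
  assumes "L > 0" "\<forall>\<^sub>F x in F. p x < q x" "filterlim X F sequentially"
    and lim: "\<And>v. 0 < v \<Longrightarrow> v < L \<Longrightarrow> ((\<lambda>x. gap (p x) (q x) L v) \<longlongrightarrow> L - v) F"
  shows "(\<lambda>n. Theta (p (X n)) (q (X n)) (exp L)) \<longlonglongrightarrow> arccos (1 / exp L)"
proof (rule tendsto_Theta_along[where c = "L\<^sup>2 / (L - L / 2)", OF assms(3,2)])
  show "((\<lambda>x. L\<^sup>2 / gap (p x) (q x) L (L / 2)) \<longlongrightarrow> L\<^sup>2 / (L - L / 2)) F"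
    using assms(1) by (intro tendsto_intros lim) auto
  show "((\<lambda>x. L * Jint (p x) (q x) L (L * t)) \<longlongrightarrow> L * (1 / sqrt (exp (2 * (L - L * t)) - 1))) F"
    if "0 < t" "t < 1" for t
    unfolding Jint_def using that assms(1) by (intro tendsto_intros tendsto_inverse_sqrt_exp lim) auto
qed (use assms(1) has_integral_limit_profile[OF assms(1)] in auto)

lemma tendsto_Theta_p_at_bot:
  assumes "r > 1"
  shows "((\<lambda>p. Theta p q r) \<longlongrightarrow> arccos (1 / r)) at_bot"
proof (rule tendsto_at_botI_sequentially)
  fix X :: "nat \<Rightarrow> real" assume X: "filterlim X at_bot sequentially"
  define L where "L = ln r"
  have L: "L > 0" "exp L = r" using assms by (simp_all add: L_def)
  have "(\<lambda>n. Theta (X n) q (exp L)) \<longlonglongrightarrow> arccos (1 / exp L)"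
  proof (rule tendsto_Theta_profile[OF L(1) _ X])
    show "\<forall>\<^sub>F p in at_bot. p < q" by (rule eventually_gt_at_bot)
    fix v assume v: "0 < v" "v < L"
    have lim: "((\<lambda>p::real. exp (p * w)) \<longlongrightarrow> 0) at_bot" if "w > 0" for w
      using that by real_asymp
    \<comment> \<open>As \<open>p \<rightarrow> - \<infinity>\<close> the weight of \<open>v\<close>
      tends to 1, and \<open>pinv q (pint q L) = L\<close>.\<close>
    have "((\<lambda>p. (exp (p * v) - 1) / (exp (p * L) - 1)) \<longlongrightarrow> (0 - 1) / (0 - 1)) at_bot"
      using v by (intro tendsto_intros lim) auto
    moreover have "\<forall>\<^sub>F p in at_bot. (exp (p * v) - 1) / (exp (p * L) - 1) = pint p v / pint p L"
      using eventually_gt_at_bot[of 0] by eventually_elim (simp add: pint_eq)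
    ultimately have R: "((\<lambda>p. pint p v / pint p L) \<longlongrightarrow> (0 - 1) / (0 - 1)) at_bot"
      by (rule Lim_transform_eventually)
    have "((\<lambda>p. pinv q (pint q L * (pint p v / pint p L)) - v) \<longlongrightarrow> pinv q (pint q L * ((0 - 1) / (0 - 1))) - v) at_bot"
      by (intro tendsto_diff tendsto_pinv tendsto_mult tendsto_const R) (auto simp: mult_pint)
    then show "((\<lambda>p. gap p q L v) \<longlongrightarrow> L - v) at_bot"
      by (simp add: gap_def interp_def)
  qed
  then show "(\<lambda>n. Theta (X n) q r) \<longlonglongrightarrow> arccos (1 / r)" by (simp add: L)
qed

lemma tendsto_Theta_q_at_top:
  assumes "r > 1"
  shows "((\<lambda>q. Theta p q r) \<longlongrightarrow> arccos (1 / r)) at_top"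
proof (rule tendsto_at_topI_sequentially)
  fix X :: "nat \<Rightarrow> real" assume X: "filterlim X at_top sequentially"
  define L where "L = ln r"
  have L: "L > 0" "exp L = r" using assms by (simp_all add: L_def)
  have "(\<lambda>n. Theta p (X n) (exp L)) \<longlonglongrightarrow> arccos (1 / exp L)"
  proof (rule tendsto_Theta_profile[OF L(1) _ X])
    show "\<forall>\<^sub>F q in at_top. p < q" by (rule eventually_gt_at_top)
    fix v assume v: "0 < v" "v < L"
    define R where "R = pint p v / pint p L"
    have "R > 0" using v pint_pos L(1) by (simp add: R_def)
    \<comment> \<open>For a fixed weight \<open>R > 0\<close> the logarithm grows like
      \<open>q * L\<close>.\<close>
    then have "((\<lambda>q. ln (1 + R * (exp (q * L) - 1)) / q - v) \<longlongrightarrow> L - v) at_top"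
      using L(1) by real_asymp
    moreover have "\<forall>\<^sub>F q in at_top. ln (1 + R * (exp (q * L) - 1)) / q - v = gap p q L v"
      using eventually_gt_at_top[of 0] by eventually_elim (simp add: gap_eq R_def)
    ultimately show "((\<lambda>q. gap p q L v) \<longlongrightarrow> L - v) at_top"
      by (rule Lim_transform_eventually)
  qed
  then show "(\<lambda>n. Theta p (X n) r) \<longlonglongrightarrow> arccos (1 / r)" by (simp add: L)
qed

text \<open>For \<open>L \<noteq> 0\<close> the quotient is \<open>t\<close> times the difference quotient at \<open>0\<close> of the
  function \<open>g\<close> of the proof, so that no second-order expansion in \<open>L\<close> is needed.\<close>

lemma gap_div_square_at_0:
  "((\<lambda>L. gap p q L (L * t) / L\<^sup>2) \<longlongrightarrow> (q - p) / 2 * (t * (1 - t))) (at 0)"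
proof -
  \<comment> \<open>Chosen so that the argument of \<open>pinv q\<close> in
    \<open>interp p q L (L * t)\<close> is \<open>L * t * \<rho> L\<close> for
    \<open>L \<noteq> 0\<close>; then \<open>gap p q L (L * t) = L * t * (g L - 1)\<close>.\<close>
  define \<rho> where "\<rho> L = expm1_quot (q * L) / expm1_quot (p * L) * expm1_quot (p * (L * t))" for L
  define g where "g L = \<rho> L * ln1p_quot (q * (L * t) * \<rho> L)" for L
  have e: "((\<lambda>L. expm1_quot (a * L)) has_real_derivative 1 / 2 * a) (at 0)" for a
    by (rule DERIV_chain2[where f = expm1_quot]) (use has_real_derivative_expm1_quot_0 in \<open>auto intro!: derivative_eq_intros\<close>)
  have e': "((\<lambda>L. expm1_quot (p * (L * t))) has_real_derivative 1 / 2 * (p * t)) (at 0)"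
    using e[of "p * t"] by (simp add: mult_ac)
  have \<rho>: "(\<rho> has_real_derivative (q - p + p * t) / 2) (at 0)"
    unfolding \<rho>_def[abs_def]
    by (rule DERIV_cong[OF DERIV_mult[OF DERIV_divide[OF e e] e']]) (auto simp: field_simps)
  have \<rho>0: "\<rho> 0 = 1" by (simp add: \<rho>_def)
  have l: "((\<lambda>L. ln1p_quot (q * (L * t) * \<rho> L)) has_real_derivative - (1 / 2) * (q * t)) (at 0)"
    by (rule DERIV_chain2[where f = ln1p_quot])
      (use has_real_derivative_ln1p_quot_0 \<rho>0 in \<open>auto intro!: derivative_eq_intros \<rho>\<close>)
  have "(g has_real_derivative (q - p) / 2 * (1 - t)) (at 0)"
    unfolding g_def[abs_def] by (rule DERIV_cong[OF DERIV_mult[OF \<rho> l]]) (auto simp: \<rho>0 field_simps)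
  moreover have "g 0 = 1" by (simp add: g_def \<rho>0)
  ultimately have "((\<lambda>L. (g L - 1) / L) \<longlongrightarrow> (q - p) / 2 * (1 - t)) (at 0)"
    by (simp add: DERIV_def)
  then have "((\<lambda>L. t * ((g L - 1) / L)) \<longlongrightarrow> t * ((q - p) / 2 * (1 - t))) (at 0)"
    by (intro tendsto_intros)
  moreover have "t * ((g L - 1) / L) = gap p q L (L * t) / L\<^sup>2" if "L \<noteq> 0" for L
  proof -
    have "gap p q L (L * t) = L * t * (g L - 1)"
      using that by (simp add: gap_def interp_def pint_def pinv_def g_def \<rho>_def algebra_simps)
    then show ?thesis using that by (simp add: power2_eq_square)
  qed
  then have "\<forall>\<^sub>F L in at 0. t * ((g L - 1) / L) = gap p q L (L * t) / L\<^sup>2"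
    by (simp add: eventually_at_filter)
  ultimately have "((\<lambda>L. gap p q L (L * t) / L\<^sup>2) \<longlongrightarrow> t * ((q - p) / 2 * (1 - t))) (at 0)"
    by (rule Lim_transform_eventually)
  then show ?thesis by (simp add: algebra_simps)
qed

lemma tendsto_Theta_at_1:
  assumes "p < q"
  shows "((\<lambda>r. Theta p q r) \<longlongrightarrow> pi / sqrt (q - p)) (at_right 1)"
proof (rule tendsto_at_right_sequentially[of 1 2])
  fix R :: "nat \<Rightarrow> real" assume R: "\<And>n. 1 < R n" "R \<longlonglongrightarrow> 1"
  have "(\<lambda>n. ln (R n)) \<longlonglongrightarrow> ln 1" by (intro tendsto_intros R) auto
  moreover have "ln (R n) > 0" for n using R(1)[of n] by simp
  ultimately have X: "filterlim (\<lambda>n. ln (R n)) (at_right 0) sequentially"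
    by (simp add: filterlim_at less_imp_neq[symmetric])
  have gap: "((\<lambda>L. gap p q L (L * t) / L\<^sup>2) \<longlongrightarrow> (q - p) / 2 * (t * (1 - t))) (at_right 0)" for t
    by (rule tendsto_mono[OF _ gap_div_square_at_0]) (simp add: at_le)
  have pos: "\<forall>\<^sub>F L in at_right (0::real). L > 0" by (simp add: eventually_at_filter)
  have "(\<lambda>n. Theta p q (exp (ln (R n)))) \<longlonglongrightarrow> pi / sqrt (q - p)"
  proof (rule tendsto_Theta_along[OF X _ pos])
    \<comment> \<open>The instance \<open>t = 1 / 2\<close> of the expansion bounds the quotient
      that controls the domination.\<close>
    have "((\<lambda>L. inverse (gap p q L (L * (1 / 2)) / L\<^sup>2)) \<longlongrightarrow> inverse ((q - p) / 2 * (1 / 2 * (1 - 1 / 2)))) (at_right 0)"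
      using assms by (intro tendsto_inverse gap) auto
    then show "((\<lambda>L. L\<^sup>2 / gap p q L (L / 2)) \<longlongrightarrow> inverse ((q - p) / 2 * (1 / 2 * (1 - 1 / 2)))) (at_right 0)"
      by simp
    have "((\<lambda>t. 1 / sqrt (q - p) * (1 / sqrt (t * (1 - t)))) has_integral 1 / sqrt (q - p) * pi) {0<..<1}"
      by (intro has_integral_mult_right has_integral_inverse_sqrt_parabola)
    then show "((\<lambda>t. 1 / sqrt (q - p) * (1 / sqrt (t * (1 - t)))) has_integral pi / sqrt (q - p)) {0<..<1}"
      by simp
    fix t :: real assume t: "0 < t" "t < 1"
    define D where "D L = gap p q L (L * t)" for L
    have D: "((\<lambda>L. D L / L\<^sup>2) \<longlongrightarrow> (q - p) / 2 * (t * (1 - t))) (at_right 0)"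
      unfolding D_def by (rule gap)
    have "((\<lambda>L. D L / L\<^sup>2 * L\<^sup>2) \<longlongrightarrow> (q - p) / 2 * (t * (1 - t)) * 0\<^sup>2) (at_right 0)"
      by (intro tendsto_intros D)
    moreover have "\<forall>\<^sub>F L in at_right 0. D L / L\<^sup>2 * L\<^sup>2 = D L"
      using pos by eventually_elim simp
    ultimately have "(D \<longlongrightarrow> (q - p) / 2 * (t * (1 - t)) * 0\<^sup>2) (at_right 0)"
      by (rule Lim_transform_eventually)
    then have "(D \<longlongrightarrow> 0) (at_right 0)" by simp
    \<comment> \<open>Writing \<open>exp (2 * D L) - 1\<close> as
      \<open>2 * D L * expm1_quot (2 * D L)\<close> allows division by \<open>L\<^sup>2\<close>; the
      limit is \<open>(q - p) * (t * (1 - t))\<close>.\<close>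
    then have "((\<lambda>L. 2 * (D L / L\<^sup>2) * expm1_quot (2 * D L)) \<longlongrightarrow>
        2 * ((q - p) / 2 * (t * (1 - t))) * expm1_quot (2 * 0)) (at_right 0)"
      by (intro tendsto_intros D)
    then have "((\<lambda>L. 1 / sqrt (2 * (D L / L\<^sup>2) * expm1_quot (2 * D L))) \<longlongrightarrow>
        1 / sqrt (2 * ((q - p) / 2 * (t * (1 - t))) * expm1_quot (2 * 0))) (at_right 0)"
      using assms t by (intro tendsto_divide tendsto_real_sqrt tendsto_const) auto
    moreover have "\<forall>\<^sub>F L in at_right 0. 1 / sqrt (2 * (D L / L\<^sup>2) * expm1_quot (2 * D L)) = L * Jint p q L (L * t)"
      using pos
    proof eventually_elim
      case (elim L)
      have "2 * (D L / L\<^sup>2) * expm1_quot (2 * D L) = (exp (2 * D L) - 1) / L\<^sup>2"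
        by (simp flip: mult_expm1_quot)
      then show ?case using elim by (simp add: real_sqrt_divide Jint_def D_def)
    qed
    ultimately have "((\<lambda>L. L * Jint p q L (L * t)) \<longlongrightarrow>
        1 / sqrt (2 * ((q - p) / 2 * (t * (1 - t))) * expm1_quot (2 * 0))) (at_right 0)"
      by (rule Lim_transform_eventually)
    then show "((\<lambda>L. L * Jint p q L (L * t)) \<longlongrightarrow> 1 / sqrt (q - p) * (1 / sqrt (t * (1 - t)))) (at_right 0)"
      by (simp add: real_sqrt_mult)
  qed (use assms in auto)
  then show "(\<lambda>n. Theta p q (R n)) \<longlonglongrightarrow> pi / sqrt (q - p)"
    using R(1) by (simp add: less_trans[OF zero_less_one])
qed simp

section \<open>Special values\<close>

text \<open>For the special values, \<open>h\<close> runs from -1 to 1 and the integral equals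
  \<open>c * pi\<close>; a factor \<open>c \<noteq> 1\<close> occurs when the substitution is in
  \<open>x\<^sup>2\<close>.\<close>

lemma Theta_eq_arcsin_diff:
  assumes "r > 1" "continuous_on {1..r} h" "\<And>x. 1 \<le> x \<Longrightarrow> x \<le> r \<Longrightarrow> \<bar>h x\<bar> \<le> 1"
    and "\<And>x. 1 < x \<Longrightarrow> x < r \<Longrightarrow> (h has_real_derivative h' x) (at x)"
    and "\<And>x. 1 < x \<Longrightarrow> x < r \<Longrightarrow> \<bar>h x\<bar> < 1"
    and "\<And>x. 1 < x \<Longrightarrow> x < r \<Longrightarrow> Theta_integrand p q r x = c * (h' x / sqrt (1 - (h x)\<^sup>2))"
  shows "Theta p q r = c * (arcsin (h r) - arcsin (h 1))"
proof -
  have "((\<lambda>x. c * (h' x / sqrt (1 - (h x)\<^sup>2))) has_integral c * (arcsin (h r) - arcsin (h 1))) {1<..<r}"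
    by (intro has_integral_mult_right has_integral_arcsin_comp[OF _ assms(2-5)]) (use assms(1) in auto)
  then have "(Theta_integrand p q r has_integral c * (arcsin (h r) - arcsin (h 1))) {1<..<r}"
    by (rule has_integral_eq[rotated]) (use assms(6) in simp)
  then have "integral {1<..<r} (Theta_integrand p q r) = c * (arcsin (h r) - arcsin (h 1))"
    by (rule integral_unique)
  then show ?thesis by (simp add: Theta_def integral_open_interval_real)
qed

text \<open>The radicand is \<open>(x - 1) * (r - x)\<close>, and \<open>h\<close> is the affine map
  of \<open>[1, r]\<close> onto \<open>[-1, 1]\<close>.\<close>

lemma Theta_1_2:
  assumes "r > 1"
  shows "Theta 1 2 r = pi"
proof -
  have "Theta 1 2 r = 1 * (arcsin ((2 * r - 1 - r) / (r - 1)) - arcsin ((2 * 1 - 1 - r) / (r - 1)))"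
  proof (rule Theta_eq_arcsin_diff[where h' = "\<lambda>_. 2 / (r - 1)"])
    fix x assume x: "1 < x" "x < r"
    have base: "(r - r\<^sup>2) / (r - 1) + (r\<^sup>2 - 1) / (r - 1) * x = r * (x - 1) + x"
      using assms by (simp add: divide_simps power2_eq_square) (simp add: algebra_simps)
    have "r * (x - 1) + x > 0" using x assms by (intro add_pos_pos mult_pos_pos) auto
    with base have "Theta_integrand 1 2 r x = 1 / sqrt ((x - 1) * (r - x))"
      using x assms by (simp add: Theta_integrand_def) (simp add: power2_eq_square algebra_simps)
    moreover have "1 - ((2 * x - 1 - r) / (r - 1))\<^sup>2 = 2\<^sup>2 * ((x - 1) * (r - x)) / (r - 1)\<^sup>2"
      using assms by (simp add: divide_simps) (simp add: power2_eq_square algebra_simps)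
    then have "sqrt (1 - ((2 * x - 1 - r) / (r - 1))\<^sup>2) = 2 * sqrt ((x - 1) * (r - x)) / (r - 1)"
      using assms by (simp only: real_sqrt_mult real_sqrt_divide) simp
    moreover have "2 / (r - 1) / (2 * s / (r - 1)) = 1 / s" for s
      using assms by (simp add: divide_simps)
    moreover show "((\<lambda>x. (2 * x - 1 - r) / (r - 1)) has_real_derivative 2 / (r - 1)) (at x)"
      using assms by (auto intro!: derivative_eq_intros simp: divide_simps)
    ultimately show "Theta_integrand 1 2 r x = 1 * (2 / (r - 1) / sqrt (1 - ((2 * x - 1 - r) / (r - 1))\<^sup>2))"
      by simp
  qed (use assms in \<open>auto simp: abs_le_iff abs_less_iff field_simps intro!: continuous_intros\<close>)
  moreover have "(2 * r - 1 - r) / (r - 1) = 1" "(2 * 1 - 1 - r) / (r - 1) = -1"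
    using assms by (simp_all add: field_simps)
  ultimately show ?thesis by (simp only: arcsin_1 arcsin_minus_1) simp
qed

text \<open>The integrand is \<open>x / sqrt ((x\<^sup>2 - 1) * (r\<^sup>2 - x\<^sup>2))\<close>;
  with \<open>x\<^sup>2\<close> as variable this is half of the integrand of an affine
  arcsine.\<close>

lemma Theta_minus2_2:
  assumes "r > 1"
  shows "Theta (-2) 2 r = pi / 2"
proof -
  have r2: "r\<^sup>2 > 1" using assms by simp
  have "Theta (-2) 2 r = 1 / 2 * (arcsin ((2 * r\<^sup>2 - 1 - r\<^sup>2) / (r\<^sup>2 - 1)) - arcsin ((2 * 1\<^sup>2 - 1 - r\<^sup>2) / (r\<^sup>2 - 1)))"
  proof (rule Theta_eq_arcsin_diff[where h' = "\<lambda>x. 4 * x / (r\<^sup>2 - 1)"])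
    fix x assume x: "1 < x" "x < r"
    have x2: "1 < x\<^sup>2" "x\<^sup>2 < r\<^sup>2" using x by (auto intro: power_strict_mono)
    show "\<bar>(2 * x\<^sup>2 - 1 - r\<^sup>2) / (r\<^sup>2 - 1)\<bar> < 1"
      using x2 r2 by (auto simp: abs_less_iff field_simps)
    have base: "(1 / r\<^sup>2 - r\<^sup>2) / (1 / r\<^sup>2 - 1) + (r\<^sup>2 - 1) / (1 / r\<^sup>2 - 1) * (1 / x\<^sup>2) = 1 + r\<^sup>2 * (1 - 1 / x\<^sup>2)"
    proof -
      have "1 / r\<^sup>2 - 1 \<noteq> 0" using r2 by (simp add: field_simps)
      then have "(1 / r\<^sup>2 - r\<^sup>2) / (1 / r\<^sup>2 - 1) = 1 + r\<^sup>2" "(r\<^sup>2 - 1) / (1 / r\<^sup>2 - 1) = - r\<^sup>2"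
        using assms by (simp_all add: field_simps power2_eq_square)
      then show ?thesis by (simp add: algebra_simps)
    qed
    have "1 - 1 / x\<^sup>2 > 0" using x2 x by (simp add: divide_less_eq)
    then have "1 + r\<^sup>2 * (1 - 1 / x\<^sup>2) > 0" by (intro add_pos_nonneg mult_nonneg_nonneg) auto
    with base have "Theta_integrand (-2) 2 r x = 1 / sqrt (1 + r\<^sup>2 * (1 - 1 / x\<^sup>2) - x\<^sup>2)"
      using x assms by (simp add: Theta_integrand_def powr_minus inverse_eq_divide)
    moreover have "1 + r\<^sup>2 * (1 - 1 / x\<^sup>2) - x\<^sup>2 = (x\<^sup>2 - 1) * (r\<^sup>2 - x\<^sup>2) / x\<^sup>2"
      using x by (simp add: field_simps power2_eq_square)
    ultimately have "Theta_integrand (-2) 2 r x = x / sqrt ((x\<^sup>2 - 1) * (r\<^sup>2 - x\<^sup>2))"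
      using x by (simp add: real_sqrt_divide)
    moreover have "1 - ((2 * x\<^sup>2 - 1 - r\<^sup>2) / (r\<^sup>2 - 1))\<^sup>2 = 2\<^sup>2 * ((x\<^sup>2 - 1) * (r\<^sup>2 - x\<^sup>2)) / (r\<^sup>2 - 1)\<^sup>2"
    proof -
      have "1 - ((2 * a - 1 - b) / (b - 1))\<^sup>2 = 2\<^sup>2 * ((a - 1) * (b - a)) / (b - 1)\<^sup>2" if "b > 1" for a b :: real
        using that by (simp add: divide_simps) (simp add: power2_eq_square algebra_simps)
      then show ?thesis using r2 .
    qed
    then have "sqrt (1 - ((2 * x\<^sup>2 - 1 - r\<^sup>2) / (r\<^sup>2 - 1))\<^sup>2) = 2 * sqrt ((x\<^sup>2 - 1) * (r\<^sup>2 - x\<^sup>2)) / (r\<^sup>2 - 1)"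
      using r2 by (simp only: real_sqrt_mult real_sqrt_divide) simp
    ultimately show "Theta_integrand (-2) 2 r x
        = 1 / 2 * (4 * x / (r\<^sup>2 - 1) / sqrt (1 - ((2 * x\<^sup>2 - 1 - r\<^sup>2) / (r\<^sup>2 - 1))\<^sup>2))"
      using r2 by simp
    show "((\<lambda>x. (2 * x\<^sup>2 - 1 - r\<^sup>2) / (r\<^sup>2 - 1)) has_real_derivative 4 * x / (r\<^sup>2 - 1)) (at x)"
      using r2 by (auto intro!: derivative_eq_intros)
  next
    fix x assume x: "1 \<le> x" "x \<le> r"
    then have "1 \<le> x\<^sup>2" "x\<^sup>2 \<le> r\<^sup>2" by (auto intro: power_mono)
    then show "\<bar>(2 * x\<^sup>2 - 1 - r\<^sup>2) / (r\<^sup>2 - 1)\<bar> \<le> 1"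
      using r2 by (auto simp: abs_le_iff field_simps)
  qed (use assms in \<open>auto simp: power2_eq_1_iff intro!: continuous_intros\<close>)
  moreover have "(2 * r\<^sup>2 - 1 - r\<^sup>2) / (r\<^sup>2 - 1) = 1" "(2 * 1\<^sup>2 - 1 - r\<^sup>2) / (r\<^sup>2 - 1) = -1"
    using r2 by (simp_all add: field_simps)
  ultimately show ?thesis by (simp only: arcsin_1 arcsin_minus_1) simp
qed

text \<open>The base of the power is, up to a constant factor, the derivative of
  \<open>x - r / x\<close>, which suggests the choice of \<open>h\<close>.\<close>

lemma Theta_minus2_minus1:
  assumes "r > 1"
  shows "Theta (-2) (-1) r = pi"
proof -
  have "Theta (-2) (-1) r = 1 * (arcsin ((r - r / r) / (r - 1)) - arcsin ((1 - r / 1) / (r - 1)))"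
  proof (rule Theta_eq_arcsin_diff[where h' = "\<lambda>x. (1 + r / x\<^sup>2) / (r - 1)"])
    fix x assume x: "1 \<le> x" "x \<le> r"
    \<comment> \<open>These products are \<open>x * (r - 1) + (x\<^sup>2 - r)\<close> and
      \<open>x * (r - 1) - (x\<^sup>2 - r)\<close>.\<close>
    have "(x - 1) * (x + r) \<ge> 0" "(r - x) * (x + 1) \<ge> 0" using x assms by auto
    then show "\<bar>(x - r / x) / (r - 1)\<bar> \<le> 1"
      using x assms by (simp add: abs_le_iff field_simps)
  next
    fix x assume x: "1 < x" "x < r"
    have "(x - 1) * (x + r) > 0" "(r - x) * (x + 1) > 0" using x assms by auto
    then show lt: "\<bar>(x - r / x) / (r - 1)\<bar> < 1"
      using x assms by (simp add: abs_less_iff field_simps)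
    \<comment> \<open>The substitution \<open>u = x - r / x\<close> turns the integrand into \<open>1 / sqrt ((r - 1)\<^sup>2 - u\<^sup>2)\<close>.\<close>
    have base: "(1 / r\<^sup>2 - 1 / r) / (1 / r\<^sup>2 - 1) + (1 / r - 1) / (1 / r\<^sup>2 - 1) * (1 / x\<^sup>2) = (1 + r / x\<^sup>2) / (1 + r)"
    proof -
      have "1 / r\<^sup>2 - 1 = (1 - r) * (1 + r) / r\<^sup>2" using assms by (simp add: field_simps power2_eq_square)
      moreover have "1 / r\<^sup>2 - 1 / r = (1 - r) / r\<^sup>2" "1 / r - 1 = (1 - r) * r / r\<^sup>2"
        using assms by (simp_all add: field_simps power2_eq_square)
      ultimately have "(1 / r\<^sup>2 - 1 / r) / (1 / r\<^sup>2 - 1) = 1 / (1 + r)" "(1 / r - 1) / (1 / r\<^sup>2 - 1) = r / (1 + r)"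
        using assms by simp_all
      then show ?thesis by (simp add: add_divide_distrib)
    qed
    define B where "B = (1 + r / x\<^sup>2) / (1 + r)"
    have B: "B > 0" using x assms by (auto simp: B_def intro!: divide_pos_pos add_pos_pos)
    have "B powr (-2) = 1 / B\<^sup>2" using B by (simp add: powr_minus inverse_eq_divide)
    with base have "Theta_integrand (-2) (-1) r x = 1 / sqrt (1 / B\<^sup>2 - x\<^sup>2)"
      using x assms by (simp add: Theta_integrand_def powr_minus inverse_eq_divide flip: B_def)
    moreover have "1 / B\<^sup>2 - x\<^sup>2 = (1 - ((x - r / x) / (r - 1))\<^sup>2) / ((1 + r / x\<^sup>2) / (r - 1))\<^sup>2"
    proof -
      \<comment> \<open>The squares of \<open>1 + r\<close> and \<open>r - 1\<close> differ by
        \<open>4 * r\<close>, as do those of \<open>x + r / x\<close> and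
        \<open>x - r / x\<close>.\<close>
      have "(1 + r)\<^sup>2 - x\<^sup>2 * (1 + r / x\<^sup>2)\<^sup>2 = (r - 1)\<^sup>2 - (x - r / x)\<^sup>2"
        using x by (simp add: field_simps power2_eq_square)
      moreover have "1 / (k / (1 + r))\<^sup>2 - x\<^sup>2 = (1 - (u / (r - 1))\<^sup>2) / (k / (r - 1))\<^sup>2"
        if "k > 0" "(1 + r)\<^sup>2 - x\<^sup>2 * k\<^sup>2 = (r - 1)\<^sup>2 - u\<^sup>2" for k u
      proof -
        have "1 / (k / (1 + r))\<^sup>2 - x\<^sup>2 = ((1 + r)\<^sup>2 - x\<^sup>2 * k\<^sup>2) / k\<^sup>2"
          using that(1) by (simp add: power_divide diff_divide_distrib)
        also have "\<dots> = (1 - (u / (r - 1))\<^sup>2) / (k / (r - 1))\<^sup>2"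
          unfolding that(2) using that(1) assms by (simp add: power_divide divide_simps)
        finally show ?thesis .
      qed
      moreover have "1 + r / x\<^sup>2 > 0" using assms by (intro add_pos_nonneg) auto
      ultimately show ?thesis unfolding B_def by blast
    qed
    moreover have "(1 + r / x\<^sup>2) / (r - 1) > 0" using assms by (intro divide_pos_pos add_pos_nonneg) auto
    moreover have "1 / sqrt (a / k\<^sup>2) = 1 * (k / sqrt a)" if "k > 0" for a k
      using that by (simp add: real_sqrt_divide)
    ultimately show "Theta_integrand (-2) (-1) r x = 1 * ((1 + r / x\<^sup>2) / (r - 1) / sqrt (1 - ((x - r / x) / (r - 1))\<^sup>2))"
      by presburger
    show "((\<lambda>x. (x - r / x) / (r - 1)) has_real_derivative (1 + r / x\<^sup>2) / (r - 1)) (at x)"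
      using x assms by (auto intro!: derivative_eq_intros simp: power2_eq_square)
  qed (use assms in \<open>auto intro!: continuous_intros\<close>)
  moreover have "(r - r / r) / (r - 1) = 1" "(1 - r / 1) / (r - 1) = -1"
    using assms by (simp_all add: field_simps)
  ultimately show ?thesis by (simp only: arcsin_1 arcsin_minus_1) simp
qed

theorem theorem3p1:
  shows "continuous_on {(p, q, r). p < q \<and> 1 < r} (\<lambda>(p, q, r). Theta p q r)
    \<and> (\<forall>q r. 1 < r \<longrightarrow> ((\<lambda>p. Theta p q r) \<longlongrightarrow> arccos (1 / r)) at_bot)
    \<and> (\<forall>p r. 1 < r \<longrightarrow> ((\<lambda>q. Theta p q r) \<longlongrightarrow> arccos (1 / r)) at_top)
    \<and> (\<forall>p q. p < q \<longrightarrow> ((\<lambda>r. Theta p q r) \<longlongrightarrow> pi / sqrt (q - p)) (at_right 1))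
    \<and> (\<forall>p q. p < 0 \<and> 0 < q \<longrightarrow> ((\<lambda>r. Theta p q r) \<longlongrightarrow> pi / 2) at_top)
    \<and> (\<forall>p q. 0 \<le> p \<and> p < q \<longrightarrow> ((\<lambda>r. Theta p q r) \<longlongrightarrow> q / (q - p) * (pi / 2)) at_top)
    \<and> (\<forall>r. 1 < r \<longrightarrow> Theta 1 2 r = pi \<and> Theta (-2) (-1) r = pi \<and> Theta (-2) 2 r = pi / 2)"
proof (intro conjI allI impI)
  show "((\<lambda>r. Theta p q r) \<longlongrightarrow> pi / 2) at_top" if "p < 0 \<and> 0 < q" for p q
    using tendsto_Theta_at_top[of p q] that by simp
  show "((\<lambda>r. Theta p q r) \<longlongrightarrow> q / (q - p) * (pi / 2)) at_top" if "0 \<le> p \<and> p < q" for p q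
  proof -
    have "pi / (2 * (1 - max 0 p / q)) = q / (q - p) * (pi / 2)"
      using that by (simp add: field_simps)
    then show ?thesis using tendsto_Theta_at_top[of p q] that by simp
  qed
qed (simp_all add: continuous_on_Theta tendsto_Theta_p_at_bot tendsto_Theta_q_at_top tendsto_Theta_at_1
    Theta_1_2 Theta_minus2_2 Theta_minus2_minus1)

end
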